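(* Consider an iterative method with affine update rules and $\tau$ steps, $$\theta_\tau=r_0+\alpha\sum_{t=1}^{\tau}S^{t-1}(L(r_0)),$$ where $L$ is an affine operator, $S$ is a linear contracting operator and $\|r_0\|=1$. Given a unitary $U$ with cost $C_U$ that implements an $(\epsilon,\delta)$-approximate quantum multistep procedure for this iterative method, there is a quantum algorithm with running time $O(T(C_U+\log\tau))$, with $T=\frac{\tau+1}{\|\tilde\theta_\tau\|}$, that outputs a state $|\tilde\theta_\tau\rangle$ such that $$\big\|\,|\theta_\tau\rangle-|\tilde\theta_\tau\rangle\,\big\|\le\frac{\sqrt{2}\,\alpha\,\tau^2\,\epsilon}{\|\theta_\tau\|}.$$ Here $\tilde\theta_\tau=r_0+\alpha\sum_{t=1}^{\tau}\tilde S^{t-1}(\tilde L(r_0))$, where $\tilde L,\tilde S$ are the approximations to $L,S$ realized by $U$.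
   Context: Notation: for a nonzero vector $v$, $|v\rangle=\frac{1}{\|v\|}\sum_i v_i|i\rangle$ is the normalized state; garbage states $|G\rangle$ may be unnormalized. $[\tau]=\{1,\dots,\tau\}$. A linear operator $S$ is contracting if $\|Sx\|\le\|x\|$ for all $x$. The scalar $\alpha$ is the step size. By convention $\tau+1=2^\ell$ is a power of two (otherwise $\tau$ is increased). An $(\epsilon,\delta)$-approximate quantum multistep procedure for the iterative method is a procedure $U$ such that $$U:\ |0\rangle|0\rangle|0\rangle|r_0\rangle|0\rangle\to|0\rangle|0\rangle|0\rangle|r_0\rangle|0\rangle,$$ and for every $t\in[\tau]$ $$U:\ |t\rangle|0\rangle|0\rangle|r_0\rangle|0\rangle\to|t\rangle|0\rangle\Big(\alpha\|\tilde S^{t-1}(\tilde L(r_0))\|\,|t\rangle|\tilde S^{t-1}(\tilde L(r_0))\rangle|0\rangle+|G'_t\rangle|1\rangle\Big),$$ where $|G'_t\rangle$ is an unnormalized garbage state, and with probability at least $1-t\delta$ it holds that $\|S^{t-1}(L(r_0))-\tilde S^{t-1}(\tilde L(r_0))\|\le t\epsilon$. (Registers 1 and 3 store the time step, register 4 the state, registers 2 and 5 are flags.)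
   Formalization: The error bound is literal if the angle of θ and θ~ is at most π/2, else up to a global phase (it can fail otherwise); it holds when all accuracy estimates do, so with probability ≥ 1−Σtδ; running time is expected; preparing and reflecting about r_0 cost about C_U. *)

theory Defs
  imports "HOL-Probability.Probability" "Jordan_Normal_Form.Matrix"
begin

unbundle no vec_syntax

section \<open>Vectors and iterative methods\<close>

definition vnorm :: "complex vec \<Rightarrow> real" where
  "vnorm v = L2_set (\<lambda>i. cmod (v $ i)) {..<dim_vec v}"

text \<open>The amplitude vector of the normalized state; the zero vector is mapped to itself.\<close>

definition normalized :: "complex vec \<Rightarrow> complex vec" where
  "normalized v = complex_of_real (1 / vnorm v) \<cdot>\<^sub>v v"

definition linear_op :: "nat \<Rightarrow> (complex vec \<Rightarrow> complex vec) \<Rightarrow> bool" where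
  "linear_op n S \<longleftrightarrow>
     S \<in> carrier_vec n \<rightarrow> carrier_vec n \<and>
     (\<forall>x\<in>carrier_vec n. \<forall>y\<in>carrier_vec n. S (x + y) = S x + S y) \<and>
     (\<forall>c. \<forall>x\<in>carrier_vec n. S (c \<cdot>\<^sub>v x) = c \<cdot>\<^sub>v S x)"

definition affine_op :: "nat \<Rightarrow> (complex vec \<Rightarrow> complex vec) \<Rightarrow> bool" where
  "affine_op n L \<longleftrightarrow>
     (\<exists>A b. linear_op n A \<and> b \<in> carrier_vec n \<and> (\<forall>x\<in>carrier_vec n. L x = A x + b))"

definition contracting :: "nat \<Rightarrow> (complex vec \<Rightarrow> complex vec) \<Rightarrow> bool" where
  "contracting n S \<longleftrightarrow> (\<forall>x\<in>carrier_vec n. vnorm (S x) \<le> vnorm x)"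

definition update ::
  "(complex vec \<Rightarrow> complex vec) \<Rightarrow> (complex vec \<Rightarrow> complex vec) \<Rightarrow> complex vec \<Rightarrow> nat \<Rightarrow> complex vec" where
  "update L S r0 t = (S ^^ (t - 1)) (L r0)"

definition iterate ::
  "nat \<Rightarrow> nat \<Rightarrow> real \<Rightarrow> (complex vec \<Rightarrow> complex vec) \<Rightarrow> (complex vec \<Rightarrow> complex vec) \<Rightarrow>
    complex vec \<Rightarrow> complex vec" where
  "iterate n \<tau> \<alpha> L S r0 =
     vec n (\<lambda>i. r0 $ i + complex_of_real \<alpha> * (\<Sum>t=1..\<tau>. update L S r0 t $ i))"

text \<open>
  State vectors are physical states only up to a global phase c. If the angle between x and y
  exceeds a right angle, then no bound of the form sqrt 2 * norm (x - y) / norm x holds for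
  c = 1 (take y = - r x with a small positive r), so c = 1 is demanded exactly when the angle is
  at most a right angle. This is the case in particular whenever norm (x - y) is at most norm x.
\<close>

definition ket_close :: "complex vec \<Rightarrow> complex vec \<Rightarrow> real \<Rightarrow> bool" where
  "ket_close x y d \<longleftrightarrow>
     (\<exists>c. cmod c = 1 \<and> (0 \<le> Re (x \<bullet>c y) \<longrightarrow> c = 1) \<and>
          vnorm (normalized x - c \<cdot>\<^sub>v normalized y) \<le> d)"

section \<open>Approximate quantum multistep procedures\<close>

text \<open>
  A label (t, a, s, i, f) is a basis state of the five registers: t and s are the time registers
  of l qubits each (bit j of the number is qubit j), a and f are the flags (False is 0), and i is
  the basis index of the n-dimensional state register. Operators are given by their matrix
  entries, the first argument being the row.
\<close>

type_synonym label = "nat \<times> bool \<times> nat \<times> nat \<times> bool"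
type_synonym 'a operator = "'a \<Rightarrow> 'a \<Rightarrow> complex"

definition labels :: "nat \<Rightarrow> nat \<Rightarrow> label set" where
  "labels l n = {..<2 ^ l} \<times> UNIV \<times> {..<2 ^ l} \<times> {..<n} \<times> UNIV"

definition unitary_on :: "'a set \<Rightarrow> 'a operator \<Rightarrow> bool" where
  "unitary_on B U \<longleftrightarrow> (\<forall>x\<in>B. \<forall>y\<in>B.
     (\<Sum>z\<in>B. cnj (U z x) * U z y) = (if x = y then 1 else 0) \<and>
     (\<Sum>z\<in>B. U x z * cnj (U y z)) = (if x = y then 1 else 0))"

definition apply_on :: "'a set \<Rightarrow> 'a operator \<Rightarrow> ('a \<Rightarrow> complex) \<Rightarrow> 'a \<Rightarrow> complex" where
  "apply_on B U \<phi> x = (\<Sum>z\<in>B. U x z * \<phi> z)"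

definition ket5 :: "nat \<Rightarrow> bool \<Rightarrow> nat \<Rightarrow> complex vec \<Rightarrow> bool \<Rightarrow> label \<Rightarrow> complex" where
  "ket5 t a s v f = (\<lambda>(t', a', s', i, f').
     if t' = t \<and> a' = a \<and> s' = s \<and> f' = f then v $ i else 0)"

text \<open>The garbage G is an arbitrary unnormalized vector on registers 3 and 4.\<close>

definition multistep_unitary ::
  "nat \<Rightarrow> nat \<Rightarrow> nat \<Rightarrow> real \<Rightarrow> complex vec \<Rightarrow>
    label operator \<Rightarrow> (complex vec \<Rightarrow> complex vec) \<Rightarrow> (complex vec \<Rightarrow> complex vec) \<Rightarrow> bool" where
  "multistep_unitary l n \<tau> \<alpha> r0 U L S \<longleftrightarrow>
     unitary_on (labels l n) U \<and>
     (\<forall>x\<in>labels l n.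
        apply_on (labels l n) U (ket5 0 False 0 r0 False) x = ket5 0 False 0 r0 False x) \<and>
     (\<forall>t\<in>{1..\<tau>}. \<exists>G. \<forall>x\<in>labels l n.
        apply_on (labels l n) U (ket5 t False 0 r0 False) x =
          complex_of_real (\<alpha> * vnorm (update L S r0 t)) *
            ket5 t False t (normalized (update L S r0 t)) False x +
          (case x of (t', a, s, i, f) \<Rightarrow> if t' = t \<and> \<not> a \<and> f then G s i else 0))"

definition accurate_at ::
  "(complex vec \<Rightarrow> complex vec) \<Rightarrow> (complex vec \<Rightarrow> complex vec) \<Rightarrow>
   (complex vec \<Rightarrow> complex vec) \<Rightarrow> (complex vec \<Rightarrow> complex vec) \<Rightarrow>
    complex vec \<Rightarrow> real \<Rightarrow> nat \<Rightarrow> bool" where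
  "accurate_at L S L' S' r0 \<epsilon> t \<longleftrightarrow> vnorm (update L S r0 t - update L' S' r0 t) \<le> real t * \<epsilon>"

text \<open>``With probability at least p'', without requiring that P itself be measurable.\<close>

definition with_prob :: "'w measure \<Rightarrow> real \<Rightarrow> ('w \<Rightarrow> bool) \<Rightarrow> bool" where
  "with_prob M p P \<longleftrightarrow> (\<exists>E\<in>sets M. (\<forall>\<omega>\<in>E. P \<omega>) \<and> p \<le> measure M E)"

text \<open>
  For a fixed unitary the vectors it writes are determined, so the probability in the accuracy
  requirement refers to the procedure itself being random: M is the law of the triple
  (U, L', S') of the unitary and the approximations of L and S realized by it. No linearity is
  assumed of L' and S'.
\<close>

type_synonym realization =
  "label operator \<times> (complex vec \<Rightarrow> complex vec) \<times> (complex vec \<Rightarrow> complex vec)"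

definition multistep_procedure ::
  "nat \<Rightarrow> nat \<Rightarrow> nat \<Rightarrow> real \<Rightarrow> complex vec \<Rightarrow> (complex vec \<Rightarrow> complex vec) \<Rightarrow>
   (complex vec \<Rightarrow> complex vec) \<Rightarrow> real \<Rightarrow> real \<Rightarrow> realization measure \<Rightarrow> bool" where
  "multistep_procedure l n \<tau> \<alpha> r0 L S \<epsilon> \<delta> M \<longleftrightarrow>
     prob_space M \<and>
     (\<forall>(U, L', S')\<in>space M.
        L' \<in> carrier_vec n \<rightarrow> carrier_vec n \<and> S' \<in> carrier_vec n \<rightarrow> carrier_vec n \<and>
        multistep_unitary l n \<tau> \<alpha> r0 U L' S') \<and>
     (\<forall>t\<in>{1..\<tau>}. with_prob M (1 - real t * \<delta>) (\<lambda>(U, L', S'). accurate_at L S L' S' r0 \<epsilon> t))"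

section \<open>Quantum algorithms with black-box access to the procedure\<close>

text \<open>
  The machine has the five registers and k work qubits, whose joint basis state is a number
  below 2 ^ k. The state register is only accessible through U and through the input state r0:
  the machine can be started afresh with r0 in the state register, and the reflection
  1 - 2 |r0><r0| is available. Amplitude amplification needs this access to the input state of
  U; each use is charged like a call of U.
\<close>

type_synonym config = "label \<times> nat"
type_synonym state = "config \<Rightarrow> complex"

datatype wire = Reg1 nat | Reg2 | Reg3 nat | Reg5 | Work nat

fun read_wire :: "wire \<Rightarrow> config \<Rightarrow> bool" where
  "read_wire (Reg1 j) ((t, a, s, i, f), w) = bit t j"
| "read_wire Reg2 ((t, a, s, i, f), w) = a"
| "read_wire (Reg3 j) ((t, a, s, i, f), w) = bit s j"
| "read_wire Reg5 ((t, a, s, i, f), w) = f"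
| "read_wire (Work j) ((t, a, s, i, f), w) = bit w j"

definition put_bit :: "nat \<Rightarrow> bool \<Rightarrow> nat \<Rightarrow> nat" where
  "put_bit j v m = (if v then set_bit j m else unset_bit j m)"

fun write_wire :: "wire \<Rightarrow> bool \<Rightarrow> config \<Rightarrow> config" where
  "write_wire (Reg1 j) v ((t, a, s, i, f), w) = ((put_bit j v t, a, s, i, f), w)"
| "write_wire Reg2 v ((t, a, s, i, f), w) = ((t, v, s, i, f), w)"
| "write_wire (Reg3 j) v ((t, a, s, i, f), w) = ((t, a, put_bit j v s, i, f), w)"
| "write_wire Reg5 v ((t, a, s, i, f), w) = ((t, a, s, i, v), w)"
| "write_wire (Work j) v ((t, a, s, i, f), w) = ((t, a, s, i, f), put_bit j v w)"

datatype gate =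
    Single "bool operator" wire
  | CNot wire wire
  | Toffoli wire wire wire
  | CallU
  | CallU_inverse
  | Reflect wire \<comment> \<open>reflection 1 - 2 |r0><r0| on the state register, controlled by a wire\<close>

text \<open>
  A program is a flowchart with classical control. Its nodes are numbered and node 0 is the
  entry; an instruction names its successor nodes, a measurement first the one for outcome 0.
\<close>

datatype instr = Run "gate list" nat | Measure wire nat nat | Restart nat | Halt
type_synonym program = "nat \<Rightarrow> instr"

record machine =
  tbits :: nat  \<comment> \<open>number of qubits of each of the registers 1 and 3\<close>
  sdim :: nat   \<comment> \<open>dimension of the state register\<close>
  work :: nat   \<comment> \<open>number of work qubits\<close>
  inp :: "complex vec"
  box :: "label operator"

definition configs :: "machine \<Rightarrow> config set" where
  "configs m = labels (tbits m) (sdim m) \<times> {..<2 ^ work m}"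

fun gate_action :: "machine \<Rightarrow> gate \<Rightarrow> state \<Rightarrow> state" where
  "gate_action m (Single g q) \<psi> =
     (\<lambda>x. \<Sum>v\<in>UNIV. g (read_wire q x) v * \<psi> (write_wire q v x))"
| "gate_action m (CNot c q) \<psi> =
     (\<lambda>x. \<psi> (write_wire q (read_wire q x \<noteq> read_wire c x) x))"
| "gate_action m (Toffoli c d q) \<psi> =
     (\<lambda>x. \<psi> (write_wire q (read_wire q x \<noteq> (read_wire c x \<and> read_wire d x)) x))"
| "gate_action m CallU \<psi> =
     (\<lambda>(y, w). apply_on (labels (tbits m) (sdim m)) (box m) (\<lambda>z. \<psi> (z, w)) y)"
| "gate_action m CallU_inverse \<psi> =
     (\<lambda>(y, w). apply_on (labels (tbits m) (sdim m)) (\<lambda>x z. cnj (box m z x)) (\<lambda>z. \<psi> (z, w)) y)"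
| "gate_action m (Reflect c) \<psi> = (\<lambda>((t, a, s, i, f), w).
     if read_wire c ((t, a, s, i, f), w)
     then \<psi> ((t, a, s, i, f), w) -
       2 * inp m $ i * (\<Sum>j<sdim m. cnj (inp m $ j) * \<psi> ((t, a, s, j, f), w))
     else \<psi> ((t, a, s, i, f), w))"

fun valid_wire :: "nat \<Rightarrow> nat \<Rightarrow> wire \<Rightarrow> bool" where
  "valid_wire l k (Reg1 j) \<longleftrightarrow> j < l"
| "valid_wire l k (Reg3 j) \<longleftrightarrow> j < l"
| "valid_wire l k (Work j) \<longleftrightarrow> j < k"
| "valid_wire l k Reg2 \<longleftrightarrow> True"
| "valid_wire l k Reg5 \<longleftrightarrow> True"

fun valid_gate :: "nat \<Rightarrow> nat \<Rightarrow> gate \<Rightarrow> bool" where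
  "valid_gate l k (Single g q) \<longleftrightarrow> unitary_on UNIV g \<and> valid_wire l k q"
| "valid_gate l k (CNot c q) \<longleftrightarrow> c \<noteq> q \<and> valid_wire l k c \<and> valid_wire l k q"
| "valid_gate l k (Toffoli c d q) \<longleftrightarrow>
     distinct [c, d, q] \<and> valid_wire l k c \<and> valid_wire l k d \<and> valid_wire l k q"
| "valid_gate l k CallU \<longleftrightarrow> True"
| "valid_gate l k CallU_inverse \<longleftrightarrow> True"
| "valid_gate l k (Reflect c) \<longleftrightarrow> valid_wire l k c"

definition valid_program :: "nat \<Rightarrow> nat \<Rightarrow> program \<Rightarrow> bool" where
  "valid_program l k P \<longleftrightarrow> (\<forall>pc. case P pc of
      Run gs _ \<Rightarrow> \<forall>g\<in>set gs. valid_gate l k g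
    | Measure q _ _ \<Rightarrow> valid_wire l k q
    | _ \<Rightarrow> True)"

definition start_state :: "machine \<Rightarrow> state" where
  "start_state m = (\<lambda>(y, w). if w = 0 then ket5 0 False 0 (inp m) False y else 0)"

definition weight :: "machine \<Rightarrow> state \<Rightarrow> real" where
  "weight m \<psi> = (\<Sum>x\<in>configs m. (cmod (\<psi> x))\<^sup>2)"

text \<open>
  An execution is described by its branches: pairs of the current node and the unnormalized
  state, whose weight is the probability of the branch.
\<close>

fun step :: "machine \<Rightarrow> program \<Rightarrow> nat \<times> state \<Rightarrow> (nat \<times> state) list" where
  "step m P (pc, \<psi>) = (case P pc of
      Run gs nx \<Rightarrow> [(nx, fold (gate_action m) gs \<psi>)]
    | Measure q nx0 nx1 \<Rightarrow>
        [(nx0, \<lambda>x. if read_wire q x then 0 else \<psi> x), (nx1, \<lambda>x. if read_wire q x then \<psi> x else 0)]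
    | Restart nx \<Rightarrow> [(nx, \<lambda>x. complex_of_real (sqrt (weight m \<psi>)) * start_state m x)]
    | Halt \<Rightarrow> [(pc, \<psi>)])"

fun branches :: "machine \<Rightarrow> program \<Rightarrow> nat \<Rightarrow> (nat \<times> state) list" where
  "branches m P 0 = [(0, start_state m)]"
| "branches m P (Suc r) = concat (map (step m P) (branches m P r))"

fun gate_cost :: "real \<Rightarrow> gate \<Rightarrow> real" where
  "gate_cost C\<^sub>U CallU = C\<^sub>U"
| "gate_cost C\<^sub>U CallU_inverse = C\<^sub>U"
| "gate_cost C\<^sub>U (Reflect _) = C\<^sub>U"
| "gate_cost C\<^sub>U _ = 1"

text \<open>Preparing the start state is charged C_U for r0 plus one unit for each qubit.\<close>

definition start_cost :: "machine \<Rightarrow> real \<Rightarrow> real" where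
  "start_cost m C\<^sub>U = C\<^sub>U + real (2 * tbits m + 2 + work m)"

fun instr_cost :: "machine \<Rightarrow> real \<Rightarrow> instr \<Rightarrow> real" where
  "instr_cost m C\<^sub>U (Run gs _) = (\<Sum>g\<leftarrow>gs. gate_cost C\<^sub>U g)"
| "instr_cost m C\<^sub>U (Measure _ _ _) = 1"
| "instr_cost m C\<^sub>U (Restart _) = start_cost m C\<^sub>U"
| "instr_cost m C\<^sub>U Halt = 0"

text \<open>
  The running time is the expected total cost, i.e. the limit (here: every partial sum) of the
  expected cost of the first r instructions.
\<close>

definition runs_in_time :: "machine \<Rightarrow> real \<Rightarrow> program \<Rightarrow> real \<Rightarrow> bool" where
  "runs_in_time m C\<^sub>U P b \<longleftrightarrow> (\<forall>r.
     start_cost m C\<^sub>U +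
       (\<Sum>j<r. \<Sum>(pc, \<psi>)\<leftarrow>branches m P j. weight m \<psi> * instr_cost m C\<^sub>U (P pc)) \<le> b)"

text \<open>
  The program halts with probability 1, and in every halting branch the state register is in the
  pure state v, unentangled with the remaining registers (whose state is \<chi>).
\<close>

definition outputs :: "machine \<Rightarrow> program \<Rightarrow> complex vec \<Rightarrow> bool" where
  "outputs m P v \<longleftrightarrow>
     (\<lambda>r. \<Sum>(pc, \<psi>)\<leftarrow>branches m P r. if P pc = Halt then weight m \<psi> else 0) \<longlonglongrightarrow> 1 \<and>
     (\<forall>r. \<forall>(pc, \<psi>)\<in>set (branches m P r). P pc = Halt \<longrightarrow>
        (\<exists>\<chi>. \<forall>((t, a, s, i, f), w)\<in>configs m.
           \<psi> ((t, a, s, i, f), w) = \<chi> (t, a, s, f, w) * v $ i))"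

end

theory Submission
  imports Defs "HOL-Library.Nat_Bijection"
begin

text \<open>
  Hadamard gates on register 1 put its \<open>2 ^ l = \<tau> + 1\<close> values in uniform superposition. After one call of
  U, subtracting register 1 from register 3 and applying the Hadamard gates again leaves, in the component
  where both time registers and both flags are zero, the vector \<open>\<theta>' / (\<tau> + 1)\<close>. This component
  has norm \<open>sin \<phi> = 1 / T\<close>, and j Grover iterations raise it to \<open>sin ((2 j + 1) \<phi>)\<close> without changing its
  direction. As T is unknown to the program, it tries the odd multiples
  \<open>2 j + 1 = 3 ^ e\<close>: for the least K with \<open>3 ^ K \<phi> \<ge> \<pi> / 6\<close> an attempt with \<open>e = K\<close> succeeds with probability
  at least 1/4, and \<open>3 ^ K = O(T)\<close>. Stage k makes five attempts with each \<open>e \<le> k\<close>. Its cost is that of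
  \<open>O(3 ^ k)\<close> calls of U, and each stage from K on is survived with probability at most \<open>(3 / 4) ^ 5 < 1 / 4\<close>, so the expected
  cost is a convergent geometric series of order \<open>3 ^ K\<close>.
\<close>

section \<open>Circuits and their adjoints\<close>

text \<open>Powers of 3 suit an unknown angle because they are odd, as \<open>2 * j + 1\<close> must
  be, and because tripling a value below \<open>pi / 6\<close> cannot leap over the window from
  \<open>pi / 6\<close> to \<open>pi / 2\<close>, where the sine is at least \<open>1 / 2\<close>.
  Beyond the window nothing is guaranteed, since \<open>3 ^ e * \<phi>\<close> may come close to a
  multiple of \<open>pi\<close>. Ever larger exponents alone would therefore not do, and every stage
  repeats the smaller ones. Five attempts per exponent make the survival probability fall faster
  than the factor 3 by which the cost of a stage grows.

  The reflection in the start state concerns all registers, while the machine only offers a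
  controlled reflection in \<open>r0\<close> on the state register. The test whether the other
  registers are zero is therefore computed into work qubits, used as a control and uncomputed. A
  further obstacle is that states are functions on an infinite type whereas the box is constrained
  on the labels alone, so circuits are compared on \<open>configs m\<close> only.\<close>

lemma bit_put_bit [simp]: "bit (put_bit j v m) i = (if i = j then v else bit m i)"
  by (auto simp: put_bit_def bit_simps)

lemma less_power_iff_bit: "(u :: nat) < 2 ^ k \<longleftrightarrow> (\<forall>i\<ge>k. \<not> bit u i)"
proof
  assume "u < 2 ^ k"
  then show "\<forall>i\<ge>k. \<not> bit u i"
    by (metis bit_take_bit_iff not_less take_bit_nat_eq_self)
next
  assume "\<forall>i\<ge>k. \<not> bit u i"
  then have "take_bit k u = u"
    by (intro bit_eqI) (metis bit_take_bit_iff leI)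
  then show "u < 2 ^ k" by (metis take_bit_nat_less_exp)
qed

lemma put_bit_less: "m < 2 ^ l \<Longrightarrow> j < l \<Longrightarrow> put_bit j v m < 2 ^ l"
  by (auto simp: less_power_iff_bit)

lemma read_write_wire: "read_wire q (write_wire p v x) = (if q = p then v else read_wire q x)"
  by (cases x; cases q; cases p) auto

lemma put_bit_idem: "put_bit j u (put_bit j v m) = put_bit j u m"
  and put_bit_same: "put_bit j (bit m j) m = m"
  by (rule bit_eqI; simp)+

lemma write_write_wire [simp]: "write_wire q u (write_wire q v x) = write_wire q u x"
  by (cases x; cases q) (auto simp: put_bit_idem)

lemma write_read_wire [simp]: "write_wire q (read_wire q x) x = x"
  by (cases x; cases q) (auto simp: put_bit_same)

lemma write_wire_configs:
  assumes "valid_wire (tbits m) (work m) q" "x \<in> configs m"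
  shows "write_wire q v x \<in> configs m"
  using assms by (cases x; cases q) (auto simp: configs_def labels_def put_bit_less)

lemma finite_labels [simp]: "finite (labels l n)"
  by (simp add: labels_def)

lemma finite_configs [simp]: "finite (configs m)"
  by (simp add: configs_def)

definition inner_on :: "machine \<Rightarrow> state \<Rightarrow> state \<Rightarrow> complex" where
  "inner_on m \<phi> \<psi> = (\<Sum>x\<in>configs m. cnj (\<phi> x) * \<psi> x)"

text \<open>Outside \<open>configs m\<close> nothing constrains the box, so a circuit followed by
  its adjoint restores a state only there. Weights and outputs see no more than that.\<close>

definition agree_on :: "machine \<Rightarrow> state \<Rightarrow> state \<Rightarrow> bool" where
  "agree_on m \<phi> \<psi> \<longleftrightarrow> (\<forall>x\<in>configs m. \<phi> x = \<psi> x)"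

lemma agree_on_refl [simp]: "agree_on m \<psi> \<psi>"
  and agree_on_trans [trans]: "agree_on m \<phi> \<psi> \<Longrightarrow> agree_on m \<psi> \<chi> \<Longrightarrow> agree_on m \<phi> \<chi>"
  by (auto simp: agree_on_def)

lemma inner_on_cong: "agree_on m \<phi> \<phi>' \<Longrightarrow> agree_on m \<psi> \<psi>' \<Longrightarrow> inner_on m \<phi> \<psi> = inner_on m \<phi>' \<psi>'"
  by (auto simp: inner_on_def agree_on_def intro!: sum.cong)

lemma weight_cong: "agree_on m \<phi> \<psi> \<Longrightarrow> weight m \<phi> = weight m \<psi>"
  by (auto simp: weight_def agree_on_def intro!: sum.cong)

lemma inner_on_self: "inner_on m \<psi> \<psi> = complex_of_real (weight m \<psi>)"
  by (simp add: inner_on_def weight_def mult.commute[of "cnj _"] flip: complex_norm_square)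

lemma weight_scale: "weight m (\<lambda>x. c * \<psi> x) = (cmod c)\<^sup>2 * weight m \<psi>"
  by (simp add: weight_def norm_mult power_mult_distrib sum_distrib_left)

lemma weight_nonneg: "0 \<le> weight m \<psi>"
  by (simp add: weight_def sum_nonneg)

lemma weight_split:
  "weight m \<psi> = weight m (\<lambda>x. if R x then \<psi> x else 0) + weight m (\<lambda>x. if R x then 0 else \<psi> x)"
  unfolding weight_def sum.distrib[symmetric] by (intro sum.cong) auto

fun adjoint_gate :: "gate \<Rightarrow> gate" where
  "adjoint_gate (Single g q) = Single (\<lambda>u v. cnj (g v u)) q"
| "adjoint_gate CallU = CallU_inverse"
| "adjoint_gate CallU_inverse = CallU"
| "adjoint_gate g = g"

definition adjoint_circuit :: "gate list \<Rightarrow> gate list" where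
  "adjoint_circuit gs = rev (map adjoint_gate gs)"

abbreviation run :: "machine \<Rightarrow> gate list \<Rightarrow> state \<Rightarrow> state" where
  "run m gs \<equiv> fold (gate_action m) gs"

abbreviation valid_circuit :: "nat \<Rightarrow> nat \<Rightarrow> gate list \<Rightarrow> bool" where
  "valid_circuit l k gs \<equiv> \<forall>g\<in>set gs. valid_gate l k g"

lemma unitary_on_adjoint: "unitary_on B U \<Longrightarrow> unitary_on B (\<lambda>u v. cnj (U v u))"
  unfolding unitary_on_def by (simp add: mult.commute)

lemma valid_adjoint_gate: "valid_gate l k g \<Longrightarrow> valid_gate l k (adjoint_gate g)"
  by (cases g) (auto simp: unitary_on_adjoint)

lemma valid_adjoint_circuit: "valid_circuit l k gs \<Longrightarrow> valid_circuit l k (adjoint_circuit gs)"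
  by (auto simp: adjoint_circuit_def valid_adjoint_gate)

lemma adjoint_adjoint_gate [simp]: "adjoint_gate (adjoint_gate g) = g"
  by (cases g) auto

lemma agree_on_gate:
  assumes "valid_gate (tbits m) (work m) g" "agree_on m \<phi> \<psi>"
  shows "agree_on m (gate_action m g \<phi>) (gate_action m g \<psi>)"
proof -
  have eq: "\<phi> x = \<psi> x" if "x \<in> configs m" for x
    using assms(2) that by (simp add: agree_on_def)
  have w: "\<phi> (write_wire q v x) = \<psi> (write_wire q v x)"
    if "x \<in> configs m" "valid_wire (tbits m) (work m) q" for q v x
    using that by (intro eq write_wire_configs)
  have "gate_action m g \<phi> x = gate_action m g \<psi> x" if "x \<in> configs m" for x
  proof (cases g)
    case (Single u q)
    then show ?thesis using that assms(1) by (simp add: w)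
  next
    case (CNot c q)
    then show ?thesis using that assms(1) by (simp add: w)
  next
    case (Toffoli c d q)
    then show ?thesis using that assms(1) by (simp add: w)
  next
    case CallU
    then show ?thesis using that by (cases x) (auto simp: apply_on_def configs_def intro!: sum.cong eq)
  next
    case CallU_inverse
    then show ?thesis using that by (cases x) (auto simp: apply_on_def configs_def intro!: sum.cong eq)
  next
    case (Reflect c)
    obtain t a s i f w where x: "x = ((t, a, s, i, f), w)" by (cases x) auto
    have "((t, a, s, j, f), w) \<in> configs m" if "j < sdim m" for j
      using that \<open>x \<in> configs m\<close> by (auto simp: x configs_def labels_def)
    then show ?thesis using Reflect that by (auto simp: x eq)
  qed
  then show ?thesis by (simp add: agree_on_def)
qed

lemma agree_on_run:
  assumes "valid_circuit (tbits m) (work m) gs" "agree_on m \<phi> \<psi>"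
  shows "agree_on m (run m gs \<phi>) (run m gs \<psi>)"
  using assms by (induction gs arbitrary: \<phi> \<psi>) (auto simp: agree_on_gate)

lemma sum_configs_permute:
  assumes "\<And>x. x \<in> configs m \<Longrightarrow> h x \<in> configs m" "\<And>x. h (h x) = x"
  shows "(\<Sum>x\<in>configs m. F (h x)) = (\<Sum>x\<in>configs m. (F x :: complex))"
  by (rule sum.reindex_bij_witness[where i = h and j = h]) (auto simp: assms)

text \<open>The two writes at \<open>x\<close> yield \<open>x\<close> and its flip at
  \<open>q\<close>, and flipping is an involution of \<open>configs m\<close>, so each configuration
  is counted twice. The doubling frees the row index of a one-qubit gate from
  \<open>read_wire q x\<close>, and taking the adjoint becomes an exchange of two sums.\<close>

lemma sum_configs_write:
  fixes F :: "config \<Rightarrow> complex"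
  assumes "valid_wire (tbits m) (work m) q"
  shows "(\<Sum>x\<in>configs m. \<Sum>v\<in>UNIV. F (write_wire q v x)) = 2 * (\<Sum>x\<in>configs m. F x)"
proof -
  define h where "h x = write_wire q (\<not> read_wire q x) x" for x
  have "(\<Sum>v\<in>UNIV. F (write_wire q v x)) = F x + F (h x)" for x
    using write_read_wire[of q x]
    by (cases "read_wire q x") (simp_all add: UNIV_bool h_def)
  then have "(\<Sum>x\<in>configs m. \<Sum>v\<in>UNIV. F (write_wire q v x)) = (\<Sum>x\<in>configs m. F x) + (\<Sum>x\<in>configs m. F (h x))"
    by (simp add: sum.distrib)
  also have "(\<Sum>x\<in>configs m. F (h x)) = (\<Sum>x\<in>configs m. F x)"
    by (rule sum_configs_permute) (auto simp: h_def read_write_wire write_wire_configs assms)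
  finally show ?thesis by simp
qed

lemma iff_cancel: "((P = Q) = Q) = P"
  by blast

lemma inner_on_permute:
  assumes "\<And>x. x \<in> configs m \<Longrightarrow> h x \<in> configs m" "\<And>x. h (h x) = x"
  shows "inner_on m (\<lambda>x. \<phi> (h x)) \<psi> = inner_on m \<phi> (\<lambda>x. \<psi> (h x))"
  using sum_configs_permute[of m h "\<lambda>x. cnj (\<phi> (h x)) * \<psi> x"] assms
  by (simp add: inner_on_def)

lemma sum_configs:
  "(\<Sum>x\<in>configs m. F x) = (\<Sum>w<2 ^ work m. \<Sum>y\<in>labels (tbits m) (sdim m). F (y, w))"
  unfolding configs_def sum.cartesian_product' by (rule sum.swap)

lemma inner_on_box:
  "inner_on m (\<lambda>(y, w). apply_on (labels (tbits m) (sdim m)) (\<lambda>x z. V x z) (\<lambda>z. \<phi> (z, w)) y) \<psi> =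
   inner_on m \<phi> (\<lambda>(y, w). apply_on (labels (tbits m) (sdim m)) (\<lambda>x z. cnj (V z x)) (\<lambda>z. \<psi> (z, w)) y)"
  (is "?l = ?r")
proof -
  let ?B = "labels (tbits m) (sdim m)"
  have "?l = (\<Sum>w<2 ^ work m. \<Sum>y\<in>?B. \<Sum>z\<in>?B. cnj (V y z * \<phi> (z, w)) * \<psi> (y, w))"
    by (simp add: inner_on_def sum_configs apply_on_def sum_distrib_right)
  also have "\<dots> = (\<Sum>w<2 ^ work m. \<Sum>z\<in>?B. \<Sum>y\<in>?B. cnj (V y z * \<phi> (z, w)) * \<psi> (y, w))"
    by (intro sum.cong refl sum.swap)
  also have "\<dots> = ?r"
    by (simp add: inner_on_def sum_configs apply_on_def sum_distrib_left mult_ac)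
  finally show ?thesis .
qed

text \<open>\<open>CNot\<close> and \<open>Toffoli\<close> permute the configurations by
  involutions, as their target differs from the controls. \<open>Reflect\<close> is left out because
  it occurs only between two zero tests, where \<open>flip_start\<close> determines its effect
  directly.\<close>

lemma inner_on_gate:
  assumes "valid_gate (tbits m) (work m) g" "\<And>c. g \<noteq> Reflect c"
  shows "inner_on m (gate_action m g \<phi>) \<psi> = inner_on m \<phi> (gate_action m (adjoint_gate g) \<psi>)"
proof (cases g)
  case (Single u q)
  then have q: "valid_wire (tbits m) (work m) q" using assms by simp
  have "2 * inner_on m (gate_action m g \<phi>) \<psi> =
    (\<Sum>x\<in>configs m. \<Sum>v\<in>UNIV. \<Sum>v'\<in>UNIV. cnj (u v v' * \<phi> (write_wire q v' x)) * \<psi> (write_wire q v x))"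
    unfolding inner_on_def sum_configs_write[OF q, symmetric]
    by (simp add: Single read_write_wire sum_distrib_right)
  also have "\<dots> = (\<Sum>x\<in>configs m. \<Sum>v'\<in>UNIV. \<Sum>v\<in>UNIV. cnj (u v v' * \<phi> (write_wire q v' x)) * \<psi> (write_wire q v x))"
    by (intro sum.cong refl sum.swap)
  also have "\<dots> = 2 * inner_on m \<phi> (gate_action m (adjoint_gate g) \<psi>)"
    unfolding inner_on_def sum_configs_write[OF q, symmetric]
    by (simp add: Single read_write_wire sum_distrib_left mult_ac)
  finally show ?thesis by simp
next
  case (CNot c q)
  let ?h = "\<lambda>x. write_wire q (read_wire q x \<noteq> read_wire c x) x"
  have "?h (?h x) = x" for x
    using iff_cancel[of "read_wire q x" "\<not> read_wire c x"] CNot assms(1) by (simp add: read_write_wire)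
  then show ?thesis
    using CNot assms(1) inner_on_permute[of m ?h \<phi> \<psi>] by (simp add: write_wire_configs)
next
  case (Toffoli c d q)
  let ?h = "\<lambda>x. write_wire q (read_wire q x \<noteq> (read_wire c x \<and> read_wire d x)) x"
  have "?h (?h x) = x" for x
    using iff_cancel[of "read_wire q x" "read_wire c x \<longrightarrow> \<not> read_wire d x"] Toffoli assms(1) by (simp add: read_write_wire)
  then show ?thesis
    using Toffoli assms(1) inner_on_permute[of m ?h \<phi> \<psi>] by (simp add: write_wire_configs)
next
  case CallU
  then show ?thesis using inner_on_box[of m "box m"] by simp
next
  case CallU_inverse
  then show ?thesis using inner_on_box[of m "\<lambda>x z. cnj (box m z x)"] by simp
qed (use assms in auto)

lemma inner_on_run:
  assumes "valid_circuit (tbits m) (work m) gs" "\<And>c. Reflect c \<notin> set gs"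
  shows "inner_on m (run m gs \<phi>) \<psi> = inner_on m \<phi> (run m (adjoint_circuit gs) \<psi>)"
  using assms
proof (induction gs arbitrary: \<phi> \<psi>)
  case (Cons g gs)
  then have "inner_on m (run m (g # gs) \<phi>) \<psi> = inner_on m (gate_action m g \<phi>) (run m (adjoint_circuit gs) \<psi>)"
    by simp
  also have "\<dots> = inner_on m \<phi> (gate_action m (adjoint_gate g) (run m (adjoint_circuit gs) \<psi>))"
    using Cons.prems by (intro inner_on_gate) auto
  finally show ?case by (simp add: adjoint_circuit_def)
qed (simp add: adjoint_circuit_def)

lemma apply_on_unitary_inverse:
  assumes "unitary_on B U" "x \<in> B" "finite B"
  shows "apply_on B (\<lambda>x z. cnj (U z x)) (apply_on B U \<phi>) x = \<phi> x"
proof -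
  have "apply_on B (\<lambda>x z. cnj (U z x)) (apply_on B U \<phi>) x = (\<Sum>z\<in>B. \<Sum>y\<in>B. cnj (U z x) * U z y * \<phi> y)"
    by (simp add: apply_on_def sum_distrib_left mult_ac)
  also have "\<dots> = (\<Sum>y\<in>B. (\<Sum>z\<in>B. cnj (U z x) * U z y) * \<phi> y)"
    by (subst sum.swap) (simp add: sum_distrib_right)
  also have "\<dots> = (\<Sum>y\<in>B. (if x = y then 1 else 0) * \<phi> y)"
    using assms by (intro sum.cong refl) (simp add: unitary_on_def)
  also have "\<dots> = (\<Sum>y\<in>B. if y = x then \<phi> y else 0)"
    by (intro sum.cong) auto
  also have "\<dots> = \<phi> x" using assms by simp
  finally show ?thesis .
qed

lemma agree_on_adjoint_gate:
  assumes "valid_gate (tbits m) (work m) g" "\<And>c. g \<noteq> Reflect c"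
    and "unitary_on (labels (tbits m) (sdim m)) (box m)"
  shows "agree_on m (gate_action m (adjoint_gate g) (gate_action m g \<phi>)) \<phi>"
proof -
  let ?B = "labels (tbits m) (sdim m)"
  have "gate_action m (adjoint_gate g) (gate_action m g \<phi>) x = \<phi> x" if x: "x \<in> configs m" for x
  proof (cases g)
    case (Single u q)
    then have u: "unitary_on UNIV u" using assms by simp
    have "gate_action m (adjoint_gate g) (gate_action m g \<phi>) x =
      apply_on UNIV (\<lambda>x z. cnj (u z x)) (apply_on UNIV u (\<lambda>v. \<phi> (write_wire q v x))) (read_wire q x)"
      by (simp add: Single apply_on_def read_write_wire)
    then show ?thesis using apply_on_unitary_inverse[OF u] by simp
  next
    case CallU
    then show ?thesis using x assms(3)
      by (cases x) (simp add: configs_def apply_on_unitary_inverse)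
  next
    case CallU_inverse
    have "unitary_on ?B (\<lambda>x z. cnj (box m z x))" by (rule unitary_on_adjoint) fact
    from apply_on_unitary_inverse[OF this]
    show ?thesis using x CallU_inverse by (cases x) (simp add: configs_def)
  qed (use assms in \<open>auto simp: read_write_wire iff_cancel\<close>)
  then show ?thesis by (simp add: agree_on_def)
qed

lemma agree_on_adjoint_circuit:
  assumes "valid_circuit (tbits m) (work m) gs" "\<And>c. Reflect c \<notin> set gs"
    and "unitary_on (labels (tbits m) (sdim m)) (box m)"
  shows "agree_on m (run m (adjoint_circuit gs) (run m gs \<phi>)) \<phi>"
  using assms(1,2)
proof (induction gs arbitrary: \<phi>)
  case (Cons g gs)
  have "agree_on m (run m (adjoint_circuit gs) (run m gs (gate_action m g \<phi>))) (gate_action m g \<phi>)"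
    using Cons by simp
  then have "agree_on m (gate_action m (adjoint_gate g) (run m (adjoint_circuit gs) (run m gs (gate_action m g \<phi>))))
     (gate_action m (adjoint_gate g) (gate_action m g \<phi>))"
    using Cons.prems by (intro agree_on_gate valid_adjoint_gate) auto
  also have "agree_on m \<dots> \<phi>"
    using Cons.prems assms(3) by (intro agree_on_adjoint_gate) auto
  finally show ?case by (simp add: adjoint_circuit_def)
qed (simp add: adjoint_circuit_def)

lemma adjoint_adjoint_circuit [simp]: "adjoint_circuit (adjoint_circuit gs) = gs"
  by (simp add: adjoint_circuit_def rev_map comp_def)

text \<open>The weight is the inner product of a state with itself; moving the circuit to the other
  side puts it next to its adjoint, which undoes it.\<close>

lemma weight_run:
  assumes "valid_circuit (tbits m) (work m) gs" "\<And>c. Reflect c \<notin> set gs"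
    and "unitary_on (labels (tbits m) (sdim m)) (box m)"
  shows "weight m (run m gs \<phi>) = weight m \<phi>"
proof -
  have "inner_on m (run m gs \<phi>) (run m gs \<phi>) = inner_on m \<phi> \<phi>"
    unfolding inner_on_run[OF assms(1,2)]
    by (intro inner_on_cong agree_on_adjoint_circuit agree_on_refl assms)
  then show ?thesis by (simp add: inner_on_self)
qed

lemma gate_action_scale: "gate_action m g (\<lambda>x. c * \<psi> x) = (\<lambda>x. c * gate_action m g \<psi> x)"
  by (cases g) (auto simp: fun_eq_iff apply_on_def sum_distrib_left right_diff_distrib mult_ac)

lemma run_scale: "run m gs (\<lambda>x. c * \<psi> x) = (\<lambda>x. c * run m gs \<psi> x)"
  by (induction gs arbitrary: \<psi>) (simp_all add: gate_action_scale)

lemma gate_action_diff: "gate_action m g (\<lambda>x. \<phi> x - \<psi> x) = (\<lambda>x. gate_action m g \<phi> x - gate_action m g \<psi> x)"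
  by (cases g) (auto simp: fun_eq_iff apply_on_def sum_subtractf algebra_simps)

lemma run_diff: "run m gs (\<lambda>x. \<phi> x - \<psi> x) = (\<lambda>x. run m gs \<phi> x - run m gs \<psi> x)"
  by (induction gs arbitrary: \<phi> \<psi>) (simp_all add: gate_action_diff)

section \<open>The amplification circuit\<close>

definition hadamard :: "bool operator" where
  "hadamard u v = complex_of_real ((if u \<and> v then - 1 else 1) / sqrt 2)"

definition pauli_x :: "bool operator" where
  "pauli_x u v = (if u = v then 0 else 1)"

definition pauli_z :: "bool operator" where
  "pauli_z u v = (if u = v then if u then - 1 else 1 else 0)"

lemma unitary_hadamard: "unitary_on UNIV hadamard"
  by (auto simp: unitary_on_def hadamard_def UNIV_bool simp flip: of_real_mult of_real_add)

lemma unitary_pauli_x: "unitary_on UNIV pauli_x"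
  by (auto simp: unitary_on_def pauli_x_def UNIV_bool)

lemma unitary_pauli_z: "unitary_on UNIV pauli_z"
  by (auto simp: unitary_on_def pauli_z_def UNIV_bool)

definition mix_time :: "nat \<Rightarrow> gate list" where
  "mix_time l = map (\<lambda>j. Single hadamard (Reg1 j)) [0..<l]"

definition add_time :: "nat \<Rightarrow> gate list" where
  "add_time l = map (\<lambda>j. CNot (Reg1 j) (Reg3 j)) [0..<l]"

text \<open>The name stands for linear combination of unitaries. U leaves a copy of the time step in
  register 3, which would keep the steps orthogonal; \<open>add_time\<close> removes the copy by an
  exclusive or, so that the second layer of Hadamard gates can add the updates.\<close>

definition lcu :: "nat \<Rightarrow> gate list" where
  "lcu l = mix_time l @ [CallU] @ add_time l @ mix_time l"

text \<open>
  On work qubits that start in 0, work qubit \<open>j + 1\<close> becomes the conjunction of work qubit j and the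
  negation of the wire \<open>q j\<close>, so it is 1 exactly if the wires \<open>q 0, \<dots>, q j\<close> are all 0.
\<close>

definition ladder :: "(nat \<Rightarrow> wire) \<Rightarrow> nat \<Rightarrow> gate list" where
  "ladder q N = Single pauli_x (Work 0) #
     concat (map (\<lambda>j. [CNot (Work j) (Work (Suc j)), Toffoli (q j) (Work j) (Work (Suc j))]) [0..<N])"

definition flag_wire :: "nat \<Rightarrow> nat \<Rightarrow> wire" where
  "flag_wire l j = (if j < l then Reg1 j else if j < 2 * l then Reg3 (j - l) else if j = 2 * l then Reg2 else Reg5)"

definition zero_test :: "nat \<Rightarrow> gate list" where
  "zero_test l = ladder (flag_wire l) (2 * l + 2)"

abbreviation result_wire :: "nat \<Rightarrow> wire" where
  "result_wire l \<equiv> Work (2 * l + 2)"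

text \<open>Gates are listed in order of time. The first line negates the good component, the
  remaining ones reflect in the state that \<open>lcu\<close> prepares. The global sign -1 of the
  textbook iterate is omitted and reappears as \<open>(- 1) ^ j\<close> in
  \<open>amplify\<close>.\<close>

definition grover :: "nat \<Rightarrow> gate list" where
  "grover l =
     (zero_test l @ [Single pauli_z (result_wire l)] @ adjoint_circuit (zero_test l)) @
     adjoint_circuit (lcu l) @
     (zero_test l @ [Reflect (result_wire l)] @ adjoint_circuit (zero_test l)) @
     lcu l"

text \<open>The last zero test is not uncomputed: its result wire is what the program
  measures.\<close>

definition attempt :: "nat \<Rightarrow> nat \<Rightarrow> gate list" where
  "attempt l j = lcu l @ concat (replicate j (grover l)) @ zero_test l"

lemma valid_lcu: "valid_circuit l k (lcu l)"
  by (auto simp: lcu_def mix_time_def add_time_def unitary_hadamard)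

lemma valid_zero_test: "2 * l + 2 < k \<Longrightarrow> valid_circuit l k (zero_test l)"
  by (auto simp: zero_test_def ladder_def unitary_pauli_x flag_wire_def)

lemma valid_grover: "2 * l + 2 < k \<Longrightarrow> valid_circuit l k (grover l)"
  using valid_lcu[of l k] valid_zero_test[of l k] valid_adjoint_circuit
  unfolding grover_def by (auto simp: unitary_pauli_z)

lemma valid_attempt: "2 * l + 2 < k \<Longrightarrow> valid_circuit l k (attempt l j)"
  using valid_lcu[of l k] valid_zero_test[of l k] valid_grover[of l k]
  by (auto simp: attempt_def)

lemma no_reflect_lcu: "Reflect c \<notin> set (lcu l)"
  by (auto simp: lcu_def mix_time_def add_time_def)

lemma no_reflect_zero_test: "Reflect c \<notin> set (zero_test l)"
  by (auto simp: zero_test_def ladder_def)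

lemma no_reflect_adjoint: "Reflect c \<notin> set gs \<Longrightarrow> Reflect c \<notin> set (adjoint_circuit gs)"
  unfolding adjoint_circuit_def by (auto, metis adjoint_adjoint_gate adjoint_gate.simps(6))

section \<open>Clean work qubits and the action of the zero test\<close>

definition clean :: "state \<Rightarrow> bool" where
  "clean \<psi> \<longleftrightarrow> (\<forall>y w. w \<noteq> 0 \<longrightarrow> \<psi> (y, w) = 0)"

fun leaves_work :: "gate \<Rightarrow> bool" where
  "leaves_work (Single g (Work j)) \<longleftrightarrow> False"
| "leaves_work (CNot c (Work j)) \<longleftrightarrow> False"
| "leaves_work (Toffoli c d (Work j)) \<longleftrightarrow> False"
| "leaves_work (Reflect c) \<longleftrightarrow> False"
| "leaves_work _ \<longleftrightarrow> True"

lemma snd_write_wire: "(\<And>j. q \<noteq> Work j) \<Longrightarrow> snd (write_wire q v x) = snd x"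
  by (cases x; cases q) auto

lemma clean_gate:
  assumes "leaves_work g" "clean \<psi>"
  shows "clean (gate_action m g \<psi>)"
proof -
  have *: "\<psi> (write_wire q v (y, w)) = 0" if "\<And>j. q \<noteq> Work j" "w \<noteq> 0" for q v y w
    using snd_write_wire[of q v "(y, w)"] that assms(2) unfolding clean_def
    by (metis prod.collapse snd_conv)
  show ?thesis
  proof (cases g)
    case (Single u q)
    then show ?thesis using assms(1) * by (cases q) (auto simp: clean_def)
  next
    case (CNot c q)
    then show ?thesis using assms(1) * by (cases q) (auto simp: clean_def)
  next
    case (Toffoli c d q)
    then show ?thesis using assms(1) * by (cases q) (auto simp: clean_def)
  qed (use assms in \<open>fastforce simp: clean_def apply_on_def intro!: sum.neutral\<close>)+
qed

lemma clean_run: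
  assumes "\<And>g. g \<in> set gs \<Longrightarrow> leaves_work g" "clean \<psi>"
  shows "clean (run m gs \<psi>)"
  using assms by (induction gs arbitrary: \<psi>) (auto simp: clean_gate)

lemma clean_lcu: "clean \<psi> \<Longrightarrow> clean (run m (lcu l) \<psi>)"
  by (rule clean_run) (auto simp: lcu_def mix_time_def add_time_def)

lemma clean_adjoint_lcu: "clean \<psi> \<Longrightarrow> clean (run m (adjoint_circuit (lcu l)) \<psi>)"
  by (rule clean_run) (auto simp: lcu_def mix_time_def add_time_def adjoint_circuit_def)

text \<open>The contents that \<open>ladder\<close> leaves in a clean work register, built up gate
  by gate; \<open>bit_tally\<close> is the closed form. The initial 1 is the effect of the gate
  \<open>pauli_x\<close> on work qubit 0.\<close>

fun tally :: "(nat \<Rightarrow> wire) \<Rightarrow> nat \<Rightarrow> label \<Rightarrow> nat" where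
  "tally q 0 y = 1"
| "tally q (Suc j) y = put_bit (Suc j) (bit (tally q j y) j \<and> \<not> read_wire (q j) (y, 0)) (tally q j y)"

lemma bit_tally: "bit (tally q j y) i \<longleftrightarrow> i \<le> j \<and> (\<forall>i'<i. \<not> read_wire (q i') (y, 0))"
  by (induction j arbitrary: i) (auto simp: bit_Suc_0_iff less_Suc_eq le_Suc_eq)

text \<open>Gates pull amplitudes back, so \<open>run_ladder\<close> has to know which
  \<open>w\<close> is carried to the previous tally. The flip of bit \<open>i\<close> controlled by
  bit \<open>j\<close> is an involution, and since bit \<open>i\<close> of \<open>u\<close> is clear
  it amounts to writing the control value there.\<close>

lemma put_bit_flip_eq_iff:
  assumes "i \<noteq> j" "\<not> bit u i"
  shows "put_bit i (bit w i \<noteq> (bit w j \<and> b)) w = u \<longleftrightarrow> w = put_bit i (bit u j \<and> b) u"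
proof
  assume *: "put_bit i (bit w i \<noteq> (bit w j \<and> b)) w = u"
  show "w = put_bit i (bit u j \<and> b) u"
    using assms by (intro bit_eqI) (auto simp flip: *)
next
  assume *: "w = put_bit i (bit u j \<and> b) u"
  show "put_bit i (bit w i \<noteq> (bit w j \<and> b)) w = u"
    using assms by (intro bit_eqI) (auto simp: *)
qed

lemma read_wire_work: "(\<And>j. q \<noteq> Work j) \<Longrightarrow> read_wire q (y, w) = read_wire q (y, 0)"
  by (cases y; cases q) auto

lemma put_bit_0_eq_0_iff: "put_bit 0 (\<not> bit w 0) w = 0 \<longleftrightarrow> w = 1"
proof
  assume *: "put_bit 0 (\<not> bit w 0) w = 0"
  have "bit w i = bit (1 :: nat) i" for i
    using arg_cong[OF *, of "\<lambda>u. bit u i"] by (cases "i = 0") (auto simp: bit_Suc_0_iff)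
  then show "w = 1" by (intro bit_eqI)
next
  assume "w = 1"
  then show "put_bit 0 (\<not> bit w 0) w = 0"
    by (intro bit_eqI) (simp add: bit_Suc_0_iff)
qed

lemma run_ladder:
  assumes "\<And>i j. i < N \<Longrightarrow> q i \<noteq> Work j" "clean \<psi>"
  shows "run m (ladder q N) \<psi> = (\<lambda>(y, w). if w = tally q N y then \<psi> (y, 0) else 0)"
  using assms(1)
proof (induction N)
  case 0
  have "run m (ladder q 0) \<psi> (y, w) = (if w = 1 then \<psi> (y, 0) else 0)" for y w
  proof -
    obtain t a s i f where y: "y = (t, a, s, i, f)" by (cases y) auto
    have "run m (ladder q 0) \<psi> (y, w) = \<psi> (y, put_bit 0 (\<not> bit w 0) w)"
      by (cases "bit w 0") (simp_all add: ladder_def pauli_x_def UNIV_bool y)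
    also have "\<dots> = (if w = 1 then \<psi> (y, 0) else 0)"
      using assms(2) put_bit_0_eq_0_iff[of w] by (cases "w = 1") (simp_all add: clean_def y del: neq0_conv)
    finally show ?thesis .
  qed
  then show ?case by auto
next
  case (Suc N)
  let ?\<phi> = "run m (ladder q N) \<psi>"
  have IH: "?\<phi> = (\<lambda>(y, w). if w = tally q N y then \<psi> (y, 0) else 0)"
    using Suc by auto
  have "run m (ladder q (Suc N)) \<psi> (y, w) = (if w = tally q (Suc N) y then \<psi> (y, 0) else 0)" for y w
  proof -
    obtain t a s i f where y: "y = (t, a, s, i, f)" by (cases y) auto
    have r: "read_wire (q N) (y, w') = read_wire (q N) (y, 0)" for w'
      using Suc.prems by (intro read_wire_work) auto
    let ?r = "read_wire (q N) (y, 0)"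
    have "run m (ladder q (Suc N)) \<psi> (y, w) = gate_action m (Toffoli (q N) (Work N) (Work (Suc N)))
        (gate_action m (CNot (Work N) (Work (Suc N))) ?\<phi>) (y, w)"
      by (simp add: ladder_def)
    \<comment> \<open>Together the two gates flip bit \<open>Suc N\<close> exactly if work qubit
      \<open>N\<close> is set and the wire \<open>q N\<close> is 0: the \<open>Toffoli\<close>
      cancels the \<open>CNot\<close> when the wire is 1.\<close>
    also have "\<dots> = ?\<phi> (y, put_bit (Suc N) (bit w (Suc N) \<noteq> (bit w N \<and> \<not> ?r)) w)"
      using r[of w] by (auto simp: y put_bit_idem iff_cancel)
    also have "\<dots> = (if w = tally q (Suc N) y then \<psi> (y, 0) else 0)"
      using put_bit_flip_eq_iff[of "Suc N" N "tally q N y" w "\<not> ?r"]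
      by (simp add: IH bit_tally)
    finally show ?thesis .
  qed
  then show ?case by auto
qed

definition count_zero :: "nat \<Rightarrow> label \<Rightarrow> nat" where
  "count_zero l = tally (flag_wire l) (2 * l + 2)"

definition zero_flags :: "nat \<Rightarrow> label \<Rightarrow> bool" where
  "zero_flags l y \<longleftrightarrow> (\<forall>j<2 * l + 2. \<not> read_wire (flag_wire l j) (y, 0))"

lemma bit_count_zero: "bit (count_zero l y) (2 * l + 2) = zero_flags l y"
  by (simp only: count_zero_def bit_tally zero_flags_def) auto

lemma run_zero_test:
  assumes "clean \<psi>"
  shows "run m (zero_test l) \<psi> = (\<lambda>(y, w). if w = count_zero l y then \<psi> (y, 0) else 0)"
  unfolding zero_test_def count_zero_def using assms by (intro run_ladder) (auto simp: flag_wire_def split: if_splits)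

lemma read_flag_wire: "read_wire (flag_wire l j) ((t, a, s, i, f), w) = read_wire (flag_wire l j) ((t, a, s, 0, f), w)"
  by (auto simp: flag_wire_def)

lemma tally_flag_wire: "tally (flag_wire l) N (t, a, s, i, f) = tally (flag_wire l) N (t, a, s, 0, f)"
  by (induction N) (simp_all add: read_flag_wire[of l _ t a s i f])

text \<open>No flag wire belongs to the state register, so the work qubits learn nothing about
  \<open>i\<close>. This keeps the output unentangled with them and lets the controlled reflection
  act on all \<open>i\<close> at once.\<close>

lemma count_zero_state: "count_zero l (t, a, s, i, f) = count_zero l (t, a, s, 0, f)"
  by (simp only: count_zero_def tally_flag_wire[of l _ t a s i f])

lemma eq_0_of_no_bit:
  assumes "t < (2 :: nat) ^ l" "\<And>j. j < l \<Longrightarrow> \<not> bit t j"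
  shows "t = 0"
  using assms by (intro bit_eqI) (metis bit_0_eq bot_apply bot_bool_def less_power_iff_bit not_less)

lemma zero_flags_iff:
  assumes "(t, a, s, i, f) \<in> labels l n"
  shows "zero_flags l (t, a, s, i, f) \<longleftrightarrow> t = 0 \<and> \<not> a \<and> s = 0 \<and> \<not> f"
proof
  assume z: "zero_flags l (t, a, s, i, f)"
  have z': "\<not> read_wire (flag_wire l j) ((t, a, s, i, f), 0)" if "j < 2 * l + 2" for j
    using z that by (simp add: zero_flags_def)
  have "\<not> bit t j" if "j < l" for j using z'[of j] that by (simp add: flag_wire_def)
  moreover have "\<not> bit s j" if "j < l" for j using z'[of "l + j"] that by (simp add: flag_wire_def)
  moreover have "\<not> a" using z'[of "2 * l"] by (simp add: flag_wire_def)
  moreover have "\<not> f" using z'[of "2 * l + 1"] by (simp add: flag_wire_def)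
  ultimately show "t = 0 \<and> \<not> a \<and> s = 0 \<and> \<not> f"
    using assms eq_0_of_no_bit by (auto simp: labels_def)
qed (auto simp: zero_flags_def flag_wire_def)

lemma vnorm_square: "(vnorm v)\<^sup>2 = (\<Sum>i<dim_vec v. (cmod (v $ i))\<^sup>2)"
  by (simp add: vnorm_def L2_set_def sum_nonneg)

section \<open>Grover rotation in the plane of the good and the bad component\<close>

locale query_machine =
  fixes m :: machine and l n :: nat and r0 :: "complex vec"
  assumes tbits [simp]: "tbits m = l" and sdim [simp]: "sdim m = n"
    and work [simp]: "work m = 2 * l + 3" and inp [simp]: "inp m = r0"
    and unitary_box: "unitary_on (labels l n) (box m)"
    and dim_r0: "dim_vec r0 = n" and norm_r0: "vnorm r0 = 1"
begin

abbreviation good :: "state \<Rightarrow> state" where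
  "good \<psi> \<equiv> \<lambda>(y, w). if zero_flags l y then \<psi> (y, w) else 0"

abbreviation bad :: "state \<Rightarrow> state" where
  "bad \<psi> \<equiv> \<lambda>(y, w). if zero_flags l y then 0 else \<psi> (y, w)"

lemma sum_good:
  assumes "\<And>y w. w \<noteq> 0 \<Longrightarrow> F (y, w) = 0"
    and "\<And>t a s i f w. (t, a, s, i, f) \<in> labels l n \<Longrightarrow> \<not> (t = 0 \<and> \<not> a \<and> s = 0 \<and> \<not> f) \<Longrightarrow> F ((t, a, s, i, f), w) = 0"
  shows "(\<Sum>x\<in>configs m. F x) = (\<Sum>i<n. F ((0, False, 0, i, False), 0))"
proof -
  have "(\<Sum>x\<in>configs m. F x) = (\<Sum>x\<in>(\<lambda>i. ((0, False, 0, i, False), 0)) ` {..<n}. F x)"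
  proof (rule sum.mono_neutral_right)
    show "\<forall>x\<in>configs m - (\<lambda>i. ((0, False, 0, i, False), 0)) ` {..<n}. F x = 0"
    proof
      fix x assume x: "x \<in> configs m - (\<lambda>i. ((0, False, 0, i, False), 0)) ` {..<n}"
      obtain t a s i f w where xx: "x = ((t, a, s, i, f), w)" by (cases x) auto
      show "F x = 0"
        using x assms(1)[of w "(t, a, s, i, f)"] assms(2)[of t a s i f w]
        by (cases "w = 0") (auto simp: xx configs_def labels_def image_iff)
    qed
  qed (auto simp: configs_def labels_def)
  also have "\<dots> = (\<Sum>i<n. F ((0, False, 0, i, False), 0))"
    by (subst sum.reindex) (auto simp: inj_on_def)
  finally show ?thesis .
qed

lemma clean_start: "clean (start_state m)"
  by (simp add: clean_def start_state_def)

lemma start_state_simp: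
  "start_state m ((t, a, s, i, f), w) = (if t = 0 \<and> \<not> a \<and> s = 0 \<and> \<not> f \<and> w = 0 then r0 $ i else 0)"
  by (simp add: start_state_def ket5_def)

lemma inner_on_start: "inner_on m (start_state m) \<psi> = (\<Sum>i<n. cnj (r0 $ i) * \<psi> ((0, False, 0, i, False), 0))"
  unfolding inner_on_def
  by (subst sum_good) (auto simp: start_state_simp)

lemma weight_start [simp]: "weight m (start_state m) = 1"
proof -
  have "complex_of_real (weight m (start_state m)) = (\<Sum>i<n. cnj (r0 $ i) * r0 $ i)"
    unfolding inner_on_self[symmetric] inner_on_start by (simp add: start_state_simp)
  also have "\<dots> = complex_of_real ((vnorm r0)\<^sup>2)"
    by (simp add: vnorm_square dim_r0 mult.commute[of "cnj _"] flip: complex_norm_square)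
  finally show ?thesis by (simp only: norm_r0 of_real_eq_iff) simp
qed

lemma weight_good: 
  assumes "clean \<psi>"
  shows "weight m (good \<psi>) = (\<Sum>i<n. (cmod (\<psi> ((0, False, 0, i, False), 0)))\<^sup>2)"
proof -
  have "complex_of_real (weight m (good \<psi>)) = 
    (\<Sum>i<n. cnj (good \<psi> ((0, False, 0, i, False), 0)) * good \<psi> ((0, False, 0, i, False), 0))"
    unfolding inner_on_self[symmetric] inner_on_def
    using assms by (intro sum_good) (auto simp: clean_def zero_flags_iff)
  also have "\<dots> = complex_of_real (\<Sum>i<n. (cmod (\<psi> ((0, False, 0, i, False), 0)))\<^sup>2)"
    by (simp add: mult.commute[of "cnj _"] zero_flags_iff[where n = n] labels_def flip: complex_norm_square)
  finally show ?thesis by (simp only: of_real_eq_iff)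
qed

lemma adjoint_zero_test:
  "agree_on m (run m (adjoint_circuit (zero_test l)) (run m (zero_test l) \<psi>)) \<psi>"
  by (rule agree_on_adjoint_circuit) (simp_all add: no_reflect_zero_test valid_zero_test unitary_box)

text \<open>Reduces a conjugated gate to its effect on tagged states, whose work register equals
  \<open>count_zero l y\<close>.\<close>

lemma run_conjugate_zero_test:
  assumes "clean \<psi>" "clean \<psi>'" "gate_action m g (run m (zero_test l) \<psi>) = run m (zero_test l) \<psi>'"
  shows "agree_on m (run m (zero_test l @ [g] @ adjoint_circuit (zero_test l)) \<psi>) \<psi>'"
  using adjoint_zero_test[of \<psi>'] by (simp add: assms)

lemma flip_good:
  assumes "clean \<psi>"
  shows "agree_on m (run m (zero_test l @ [Single pauli_z (result_wire l)] @ adjoint_circuit (zero_test l)) \<psi>)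
    (\<lambda>(y, w). if zero_flags l y then - \<psi> (y, w) else \<psi> (y, w))"
proof -
  let ?\<psi>' = "\<lambda>(y, w). if zero_flags l y then - \<psi> (y, w) else \<psi> (y, w)"
  have c: "clean ?\<psi>'" using assms by (simp add: clean_def)
  have "gate_action m (Single pauli_z (result_wire l)) \<phi> (y, w) =
    (if bit w (2 * l + 2) then - \<phi> (y, w) else \<phi> (y, w))" for \<phi> y w
  proof -
    have "write_wire (result_wire l) (bit w (2 * l + 2)) (y, w) = (y, w)"
      by (cases y) (simp only: write_wire.simps put_bit_same)
    then show ?thesis
      by (cases y; cases "bit w (2 * l + 2)") (simp_all add: pauli_z_def UNIV_bool)
  qed
  note z = this
  show ?thesis
    by (rule run_conjugate_zero_test[OF assms c])
      (simp only: run_zero_test[OF assms] run_zero_test[OF c], 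
       auto simp: fun_eq_iff z bit_count_zero simp del: gate_action.simps mult_2 add_2_eq_Suc')
qed

text \<open>The start state is supported where the time registers, the flags and the work qubits are
  zero, and there it is \<open>r0\<close>. Reflecting in \<open>r0\<close> under the control of the
  zero test is thus the reflection in the whole start state.\<close>

lemma flip_start:
  assumes "clean \<psi>"
  shows "agree_on m (run m (zero_test l @ [Reflect (result_wire l)] @ adjoint_circuit (zero_test l)) \<psi>)
    (\<lambda>x. \<psi> x - 2 * inner_on m (start_state m) \<psi> * start_state m x)"
proof -
  let ?\<psi>' = "\<lambda>((t, a, s, i, f), w). if w = 0 \<and> zero_flags l (t, a, s, i, f)
      then \<psi> ((t, a, s, i, f), 0) - 2 * r0 $ i * (\<Sum>j<n. cnj (r0 $ j) * \<psi> ((t, a, s, j, f), 0))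
      else \<psi> ((t, a, s, i, f), w)"
  have c: "clean ?\<psi>'" using assms by (simp add: clean_def)
  have t: "count_zero l (t, a, s, j, f) = count_zero l (t, a, s, i, f)" for t a s i j f
    by (metis count_zero_state)
  have "gate_action m (Reflect (result_wire l)) (run m (zero_test l) \<psi>) x = run m (zero_test l) ?\<psi>' x" for x
  proof -
    obtain t a s i f w where x: "x = ((t, a, s, i, f), w)" by (cases x) auto
    show ?thesis
    proof (cases "w = count_zero l (t, a, s, i, f)")
      case True
      then have b: "read_wire (result_wire l) x = zero_flags l (t, a, s, i, f)"
        by (simp only: x read_wire.simps bit_count_zero)
      \<comment> \<open>All basis states of the state register share one tag, so the sum in
        \<open>Reflect\<close> sees either the whole slice of \<open>\<psi>\<close> or nothing of
        it.\<close>
      have "t' = count_zero l (t, a, s, j, f) \<longleftrightarrow> t' = w" for t' j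
        using t[of t a s j f i] True by auto
      then show ?thesis
        using b by (simp only: x gate_action.simps prod.case run_zero_test[OF assms] run_zero_test[OF c]) simp
    next
      case False
      then have "w \<noteq> count_zero l (t, a, s, j, f)" for j
        using t[of t a s j f i] by simp
      then show ?thesis
        by (simp only: x gate_action.simps prod.case run_zero_test[OF assms] run_zero_test[OF c]) simp
    qed
  qed
  then have "agree_on m (run m (zero_test l @ [Reflect (result_wire l)] @ adjoint_circuit (zero_test l)) \<psi>) ?\<psi>'"
    by (intro run_conjugate_zero_test[OF assms c] ext)
  also have "agree_on m ?\<psi>' (\<lambda>x. \<psi> x - 2 * inner_on m (start_state m) \<psi> * start_state m x)"
    using assms
    by (auto simp: agree_on_def configs_def zero_flags_iff start_state_simp inner_on_start clean_def)
  finally show ?thesis .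
qed

definition \<Psi> :: state where
  "\<Psi> = run m (lcu l) (start_state m)"

definition p :: real where
  "p = weight m (good \<Psi>)"

lemma clean_\<Psi>: "clean \<Psi>"
  unfolding \<Psi>_def by (intro clean_lcu clean_start)

lemma weight_\<Psi>: "weight m \<Psi> = 1"
  unfolding \<Psi>_def by (subst weight_run) (simp_all add: valid_lcu no_reflect_lcu unitary_box)

lemma weight_good_bad: "weight m \<psi> = weight m (good \<psi>) + weight m (bad \<psi>)"
  unfolding weight_def sum.distrib[symmetric] by (intro sum.cong) auto

lemma weight_bad_\<Psi>: "weight m (bad \<Psi>) = 1 - p"
  using weight_good_bad[of \<Psi>] weight_\<Psi> by (simp add: p_def)

lemma p_bounds: "0 \<le> p" "p \<le> 1"
  using weight_nonneg[of m "good \<Psi>"] weight_nonneg[of m "bad \<Psi>"] weight_bad_\<Psi> by (simp_all add: p_def)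

text \<open>Coordinates relative to the unnormalized good and bad parts of \<open>\<Psi>\<close>.
  Normalizing the parts would divide by \<open>sqrt p\<close> and \<open>sqrt (1 - p)\<close>,
  either of which may vanish.\<close>

definition span2 :: "real \<Rightarrow> real \<Rightarrow> state" where
  "span2 X Y = (\<lambda>(y, w). of_real (if zero_flags l y then X else Y) * \<Psi> (y, w))"

lemma clean_span2: "clean (span2 X Y)"
  using clean_\<Psi> by (simp add: clean_def span2_def)

lemma inner_on_span2: "inner_on m \<Psi> (span2 X Y) = of_real (X * p + Y * (1 - p))"
proof -
  have "inner_on m \<Psi> (span2 X Y) = of_real X * inner_on m (good \<Psi>) (good \<Psi>) + of_real Y * inner_on m (bad \<Psi>) (bad \<Psi>)"
    unfolding inner_on_def sum_distrib_left sum.distrib[symmetric]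
    by (intro sum.cong) (auto simp: span2_def)
  then show ?thesis by (simp add: inner_on_self weight_bad_\<Psi> p_def)
qed

text \<open>\<open>\<Psi>\<close> itself has both coordinates 1. Negating the good part turns
  \<open>X\<close> into \<open>- X\<close>, and the reflection then subtracts twice the inner
  product with \<open>\<Psi>\<close> from both coordinates.\<close>

lemma grover_span2:
  "agree_on m (run m (grover l) (span2 X Y)) 
     (span2 (- ((1 - 2 * p) * X + 2 * (1 - p) * Y)) (2 * p * X - (1 - 2 * p) * Y))"
proof -
  let ?R1 = "zero_test l @ [Single pauli_z (result_wire l)] @ adjoint_circuit (zero_test l)"
  let ?R0 = "zero_test l @ [Reflect (result_wire l)] @ adjoint_circuit (zero_test l)"
  let ?A = "lcu l" and ?A' = "adjoint_circuit (lcu l)"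
  let ?\<phi> = "span2 (- X) Y"
  let ?c = "inner_on m (start_state m) (run m ?A' ?\<phi>)"
  have vA: "valid_circuit (tbits m) (work m) ?A" using valid_lcu by simp
  have vA': "valid_circuit (tbits m) (work m) ?A'" by (rule valid_adjoint_circuit[OF vA])
  have vR: "valid_circuit (tbits m) (work m) ?R0"
    using valid_adjoint_circuit[OF valid_zero_test, of l "work m"] valid_zero_test[of l "work m"] by auto
  have "(\<lambda>(y, w). if zero_flags l y then - span2 X Y (y, w) else span2 X Y (y, w)) = ?\<phi>"
    by (auto simp: fun_eq_iff span2_def)
  then have "agree_on m (run m ?R1 (span2 X Y)) ?\<phi>"
    using flip_good[OF clean_span2[of X Y]] by simp
  then have "agree_on m (run m (?A' @ ?R0 @ ?A) (run m ?R1 (span2 X Y))) (run m (?A' @ ?R0 @ ?A) ?\<phi>)"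
    using vA vA' vR by (intro agree_on_run) auto
  then have "agree_on m (run m (grover l) (span2 X Y)) (run m ?A (run m ?R0 (run m ?A' ?\<phi>)))"
    by (simp add: grover_def)
  also have "agree_on m \<dots> (run m ?A (\<lambda>x. run m ?A' ?\<phi> x - 2 * ?c * start_state m x))"
    by (intro agree_on_run[OF vA] flip_start clean_adjoint_lcu clean_span2)
  also have "run m ?A (\<lambda>x. run m ?A' ?\<phi> x - 2 * ?c * start_state m x) = (\<lambda>x. run m ?A (run m ?A' ?\<phi>) x - 2 * ?c * \<Psi> x)"
    by (simp only: run_diff run_scale \<Psi>_def)
  also have "agree_on m \<dots> (\<lambda>x. ?\<phi> x - 2 * ?c * \<Psi> x)"
  proof -
    have "agree_on m (run m (adjoint_circuit ?A') (run m ?A' ?\<phi>)) ?\<phi>"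
      by (rule agree_on_adjoint_circuit[OF vA']) (simp_all add: no_reflect_lcu no_reflect_adjoint unitary_box)
    then show ?thesis by (simp add: agree_on_def)
  qed
  \<comment> \<open>Moving \<open>lcu\<close> to the other side of the inner product turns the
    reflection in the start state into the one in \<open>\<Psi>\<close>.\<close>
  also have "?c = inner_on m \<Psi> ?\<phi>"
    unfolding \<Psi>_def by (rule inner_on_run[OF vA no_reflect_lcu, symmetric])
  also have "(\<lambda>x. ?\<phi> x - 2 * inner_on m \<Psi> ?\<phi> * \<Psi> x) = 
    span2 (- ((1 - 2 * p) * X + 2 * (1 - p) * Y)) (2 * p * X - (1 - 2 * p) * Y)"
    unfolding inner_on_span2 by (auto simp: fun_eq_iff span2_def algebra_simps)
  finally show ?thesis .
qed

definition angle :: real where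
  "angle = arcsin (sqrt p)"

lemma sin_angle: "sin angle = sqrt p" and cos_angle: "cos angle = sqrt (1 - p)"
  and angle_bounds: "0 \<le> angle" "angle \<le> pi / 2"
proof -
  have "0 \<le> sqrt p" "sqrt p \<le> 1" using p_bounds by auto
  then have "- 1 \<le> sqrt p" by linarith
  then show "sin angle = sqrt p" "cos angle = sqrt (1 - p)"
    using p_bounds sin_arcsin[of "sqrt p"] cos_arcsin[of "sqrt p"] \<open>sqrt p \<le> 1\<close> by (auto simp: angle_def)
  show "0 \<le> angle" "angle \<le> pi / 2"
    using \<open>- 1 \<le> sqrt p\<close> arcsin_bounded[of "sqrt p"] arcsin_le_arcsin[of 0 "sqrt p"] \<open>sqrt p \<le> 1\<close> p_bounds by (auto simp: angle_def)
qed

text \<open>In the coordinates \<open>X * sqrt p\<close> and \<open>Y * sqrt (1 - p)\<close> the map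
  of \<open>grover_span2\<close> is minus the rotation by \<open>2 * angle\<close>, since
  \<open>1 - 2 * p\<close> and \<open>2 * sqrt p * sqrt (1 - p)\<close> are the cosine and sine of
  that angle. Products instead of quotients keep the cases \<open>p = 0\<close> and
  \<open>p = 1\<close> uniform.\<close>

lemma amplify:
  "\<exists>X Y. agree_on m (run m (concat (replicate j (grover l))) \<Psi>) (span2 X Y) \<and>
     X * sqrt p = (- 1) ^ j * sin ((2 * real j + 1) * angle) \<and>
     Y * sqrt (1 - p) = (- 1) ^ j * cos ((2 * real j + 1) * angle)"
proof (induction j)
  case 0
  have "span2 1 1 = \<Psi>" by (auto simp: span2_def)
  then show ?case by (intro exI[of _ 1]) (simp add: sin_angle cos_angle)
next
  case (Suc j)
  let ?a = "sqrt p" and ?b = "sqrt (1 - p)" and ?\<phi> = "(2 * real j + 1) * angle"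
  from Suc obtain X Y where *: "agree_on m (run m (concat (replicate j (grover l))) \<Psi>) (span2 X Y)"
    and X: "X * ?a = (- 1) ^ j * sin ?\<phi>" and Y: "Y * ?b = (- 1) ^ j * cos ?\<phi>" by blast
  let ?X = "- ((1 - 2 * p) * X + 2 * (1 - p) * Y)" and ?Y = "2 * p * X - (1 - 2 * p) * Y"
  have pa: "p = ?a * ?a" and pb: "1 - p = ?b * ?b" using p_bounds real_sqrt_mult_self[of p] real_sqrt_mult_self[of "1 - p"] by linarith+
  have c2: "cos (2 * angle) = 1 - 2 * p" and s2: "sin (2 * angle) = 2 * ?a * ?b"
    using p_bounds by (simp_all add: cos_double_sin sin_double sin_angle cos_angle)
  have arg: "(2 * real (Suc j) + 1) * angle = ?\<phi> + 2 * angle" by (simp add: algebra_simps)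
  have eq: "run m (concat (replicate (Suc j) (grover l))) \<Psi> = run m (grover l) (run m (concat (replicate j (grover l))) \<Psi>)"
    by (simp flip: replicate_append_same)
  have "agree_on m (run m (grover l) (run m (concat (replicate j (grover l))) \<Psi>)) (run m (grover l) (span2 X Y))"
    by (rule agree_on_run[OF _ *]) (use valid_grover[of l "work m"] in simp)
  then have 1: "agree_on m (run m (concat (replicate (Suc j) (grover l))) \<Psi>) (span2 ?X ?Y)"
    unfolding eq using grover_span2 by (rule agree_on_trans)
  have 2: "?X * ?a = (- 1) ^ Suc j * sin (?\<phi> + 2 * angle)"
  proof -
    have "?X * ?a = - ((1 - 2 * p) * (X * ?a) + 2 * ?a * ((1 - p) * Y))"
      by (simp add: algebra_simps)
    also have "(1 - p) * Y = (?b * ?b) * Y"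
      by (simp only: pb[symmetric])
    also have "2 * ?a * (?b * ?b * Y) = 2 * ?a * ?b * (Y * ?b)"
      by (simp only: mult_ac)
    also have "- ((1 - 2 * p) * (X * ?a) + 2 * ?a * ?b * (Y * ?b)) =
        - ((1 - 2 * p) * ((- 1) ^ j * sin ?\<phi>) + 2 * ?a * ?b * ((- 1) ^ j * cos ?\<phi>))"
      by (simp only: X Y)
    also have "\<dots> = (- 1) ^ Suc j * (sin ?\<phi> * (1 - 2 * p) + cos ?\<phi> * (2 * ?a * ?b))"
      by (simp add: distrib_left distrib_right mult_ac)
    finally show ?thesis by (simp only: sin_add c2 s2)
  qed
  have 3: "?Y * ?b = (- 1) ^ Suc j * cos (?\<phi> + 2 * angle)"
  proof -
    have "?Y * ?b = 2 * p * X * ?b - (1 - 2 * p) * (Y * ?b)"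
      by (simp only: left_diff_distrib mult.assoc)
    also have "2 * p * X * ?b = 2 * (?a * ?a) * X * ?b"
      by (simp only: pa[symmetric])
    also have "\<dots> = 2 * ?a * ?b * (X * ?a)"
      by (simp only: mult_ac)
    also have "2 * ?a * ?b * (X * ?a) - (1 - 2 * p) * (Y * ?b) =
        2 * ?a * ?b * ((- 1) ^ j * sin ?\<phi>) - (1 - 2 * p) * ((- 1) ^ j * cos ?\<phi>)"
      by (simp only: X Y)
    also have "\<dots> = (- 1) ^ Suc j * (cos ?\<phi> * (1 - 2 * p) - sin ?\<phi> * (2 * ?a * ?b))"
      by (simp add: right_diff_distrib left_diff_distrib mult_ac)
    finally show ?thesis by (simp only: cos_add c2 s2)
  qed
  show ?case
    unfolding arg using 1 2 3 by (intro exI[of _ ?X] exI[of _ ?Y] conjI)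
qed

lemma weight_zero_test: "weight m (run m (zero_test l) \<psi>) = weight m \<psi>"
  by (rule weight_run) (simp_all add: valid_zero_test no_reflect_zero_test unitary_box)

definition final :: "nat \<Rightarrow> state" where
  "final j = run m (attempt l j) (start_state m)"

text \<open>Outcome 1 of the result wire selects the good component and outcome 0 the bad one; in
  their weights the sign \<open>(- 1) ^ j\<close> drops out. The three parts provide the assumptions
  of the locale \<open>retry\<close>.\<close>

lemma final_spec:
  "weight m (\<lambda>x. if read_wire (result_wire l) x then final j x else 0) = (sin ((2 * real j + 1) * angle))\<^sup>2"
  "weight m (\<lambda>x. if read_wire (result_wire l) x then 0 else final j x) = (cos ((2 * real j + 1) * angle))\<^sup>2"
  "(\<And>i. i < n \<Longrightarrow> \<Psi> ((0, False, 0, i, False), 0) = c * v $ i) \<Longrightarrow>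
   \<exists>\<chi>. \<forall>((t, a, s, i, f), w)\<in>configs m.
     (if read_wire (result_wire l) ((t, a, s, i, f), w) then final j ((t, a, s, i, f), w) else 0) = \<chi> (t, a, s, f, w) * v $ i"
proof -
  obtain X Y where *: "agree_on m (run m (concat (replicate j (grover l))) \<Psi>) (span2 X Y)"
    and X: "X * sqrt p = (- 1) ^ j * sin ((2 * real j + 1) * angle)"
    and Y: "Y * sqrt (1 - p) = (- 1) ^ j * cos ((2 * real j + 1) * angle)"
    using amplify by blast
  have "agree_on m (run m (zero_test l) (run m (concat (replicate j (grover l))) \<Psi>)) (run m (zero_test l) (span2 X Y))"
    by (rule agree_on_run[OF _ *]) (use valid_zero_test[of l "work m"] in simp)
  then have **: "agree_on m (final j) (run m (zero_test l) (span2 X Y))"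
    by (simp add: final_def attempt_def \<Psi>_def)
  have r: "read_wire (result_wire l) (y, w) = bit w (2 * l + 2)" for y w by (cases y) simp
  have c: "clean (good \<Psi>)" "clean (bad \<Psi>)" "clean (span2 X Y)"
    "clean (\<lambda>x. of_real X * good \<Psi> x)" "clean (\<lambda>x. of_real Y * bad \<Psi> x)"
    using clean_\<Psi> clean_span2[of X Y] by (simp_all add: clean_def)
  have f: "final j (y, w) = (if w = count_zero l y then span2 X Y (y, 0) else 0)" if "(y, w) \<in> configs m" for y w
    using ** that by (simp add: agree_on_def run_zero_test[OF c(3)])
  have g: "agree_on m (\<lambda>x. if read_wire (result_wire l) x then final j x else 0) (run m (zero_test l) (\<lambda>x. of_real X * good \<Psi> x))"
    by (auto simp: agree_on_def f run_zero_test[OF c(4)] r bit_count_zero span2_def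
        simp del: mult_2 add_2_eq_Suc' read_wire.simps)
  have b: "agree_on m (\<lambda>x. if read_wire (result_wire l) x then 0 else final j x) (run m (zero_test l) (\<lambda>x. of_real Y * bad \<Psi> x))"
    by (auto simp: agree_on_def f run_zero_test[OF c(5)] r bit_count_zero span2_def
        simp del: mult_2 add_2_eq_Suc' read_wire.simps)
  have "weight m (\<lambda>x. if read_wire (result_wire l) x then final j x else 0) = (X * sqrt p)\<^sup>2"
    unfolding weight_cong[OF g] weight_zero_test weight_scale using p_bounds
    by (simp add: p_def[symmetric] power_mult_distrib)
  then show "weight m (\<lambda>x. if read_wire (result_wire l) x then final j x else 0) = (sin ((2 * real j + 1) * angle))\<^sup>2"
    unfolding X by (simp add: power_mult_distrib flip: power_mult)
  have "weight m (\<lambda>x. if read_wire (result_wire l) x then 0 else final j x) = (Y * sqrt (1 - p))\<^sup>2"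
    unfolding weight_cong[OF b] weight_zero_test weight_scale using p_bounds
    by (simp add: weight_bad_\<Psi> power_mult_distrib)
  then show "weight m (\<lambda>x. if read_wire (result_wire l) x then 0 else final j x) = (cos ((2 * real j + 1) * angle))\<^sup>2"
    unfolding Y by (simp add: power_mult_distrib flip: power_mult)
  assume \<Psi>: "\<And>i. i < n \<Longrightarrow> \<Psi> ((0, False, 0, i, False), 0) = c * v $ i"
  \<comment> \<open>The good component lives on a single value of all registers except the state
    register, and there the work qubits show a fixed tag.\<close>
  let ?\<chi> = "\<lambda>(t, a, s, f, w). if w = count_zero l (t, a, s, 0, f) \<and> t = 0 \<and> \<not> a \<and> s = 0 \<and> \<not> f then of_real X * c else 0"
  have "(if read_wire (result_wire l) ((t, a, s, i, f), w) then final j ((t, a, s, i, f), w) else 0) = ?\<chi> (t, a, s, f, w) * v $ i"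
    if x: "((t, a, s, i, f), w) \<in> configs m" for t a s i f w
  proof -
    have l: "(t, a, s, i, f) \<in> labels l n" and i: "i < n" using x by (auto simp: configs_def labels_def)
    have t: "count_zero l (t, a, s, 0, f) = count_zero l (t, a, s, i, f)" by (metis count_zero_state)
    have "(if read_wire (result_wire l) ((t, a, s, i, f), w) then final j ((t, a, s, i, f), w) else 0) =
      run m (zero_test l) (\<lambda>x. of_real X * good \<Psi> x) ((t, a, s, i, f), w)"
      using g x unfolding agree_on_def by blast
    also have "\<dots> = ?\<chi> (t, a, s, f, w) * v $ i"
      using \<Psi>[OF i] by (auto simp: run_zero_test[OF c(4)] t zero_flags_iff[OF l])
    finally show ?thesis .
  qed
  then show "\<exists>\<chi>. \<forall>((t, a, s, i, f), w)\<in>configs m.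
     (if read_wire (result_wire l) ((t, a, s, i, f), w) then final j ((t, a, s, i, f), w) else 0) = \<chi> (t, a, s, f, w) * v $ i"
    by (intro exI[of _ ?\<chi>] ballI) (simp only: split_paired_all prod.case)
qed

end

section \<open>Hadamard layers and the amplitudes of the good component\<close>

lemma put_bit_False_less: "put_bit j False t < 2 ^ j \<longleftrightarrow> t < 2 ^ Suc j"
  by (auto simp: less_power_iff_bit simp del: power_Suc)

lemma put_bit_True_not_less: "\<not> put_bit j True t < 2 ^ j"
  by (auto simp: less_power_iff_bit)

lemma put_bit_dvd:
  assumes "2 ^ Suc j dvd t"
  shows "\<not> bit t j" "put_bit j False t = t" "put_bit j True t = t + 2 ^ j"
proof -
  from assms obtain c where "t = 2 ^ j * (2 * c)" by (auto simp: dvd_def mult_ac)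
  then show *: "\<not> bit t j" by (simp add: bit_iff_odd)
  show "put_bit j False t = t" using * by (intro bit_eqI) auto
  show "put_bit j True t = t + 2 ^ j" using * by (simp add: put_bit_def set_bit_eq)
qed

text \<open>Qubit \<open>j\<close> is still 0 when its Hadamard gate acts, so no sign
  enters.\<close>

lemma run_mix_time_zero:
  assumes "\<And>t a s i f w. t \<noteq> 0 \<Longrightarrow> \<psi> ((t, a, s, i, f), w) = 0"
  shows "run m (mix_time j) \<psi> ((t, a, s, i, f), w) =
    (if t < 2 ^ j then complex_of_real ((1 / sqrt 2) ^ j) * \<psi> ((0, a, s, i, f), w) else 0)"
proof (induction j arbitrary: t)
  case 0
  then show ?case using assms by (simp add: mix_time_def)
next
  case (Suc j)
  have "run m (mix_time (Suc j)) \<psi> = gate_action m (Single hadamard (Reg1 j)) (run m (mix_time j) \<psi>)"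
    by (simp add: mix_time_def)
  then show ?case
    by (simp add: UNIV_bool Suc put_bit_False_less put_bit_True_not_less hadamard_def del: power_Suc)
       (simp add: mult_ac)
qed

lemma sum_lessThan_add: "sum F {..<a + b :: nat} = sum F {..<a} + (\<Sum>u<b. F (a + u) :: 'a :: comm_monoid_add)"
  by (induction b) (simp_all add: add.assoc)

text \<open>It is applied at \<open>t = 0\<close>; the induction passes from \<open>t\<close> to
  \<open>t + 2 ^ j\<close>, hence the multiples of \<open>2 ^ j\<close>. Bit \<open>j\<close> of
  \<open>t\<close> is 0, so only the row of the Hadamard matrix without a sign occurs.\<close>

lemma run_mix_time_sum:
  assumes "2 ^ j dvd t"
  shows "run m (mix_time j) \<psi> ((t, a, s, i, f), w) =
    complex_of_real ((1 / sqrt 2) ^ j) * (\<Sum>u<2 ^ j. \<psi> ((t + u, a, s, i, f), w))"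
  using assms
proof (induction j arbitrary: t)
  case 0
  then show ?case by (simp add: mix_time_def)
next
  case (Suc j)
  have d: "2 ^ j dvd t" "2 ^ j dvd t + 2 ^ j"
    using Suc.prems dvd_trans[of "2 ^ j" "2 ^ Suc j" t] by auto
  have "run m (mix_time (Suc j)) \<psi> = gate_action m (Single hadamard (Reg1 j)) (run m (mix_time j) \<psi>)"
    by (simp add: mix_time_def)
  then have "run m (mix_time (Suc j)) \<psi> ((t, a, s, i, f), w) = complex_of_real (1 / sqrt 2) *
      (run m (mix_time j) \<psi> ((t, a, s, i, f), w) + run m (mix_time j) \<psi> ((t + 2 ^ j, a, s, i, f), w))"
    using put_bit_dvd[OF Suc.prems] by (simp add: UNIV_bool hadamard_def add_divide_distrib)
  also have "\<dots> = complex_of_real ((1 / sqrt 2) ^ Suc j) *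
     ((\<Sum>u<2 ^ j. \<psi> ((t + u, a, s, i, f), w)) + (\<Sum>u<2 ^ j. \<psi> ((t + (2 ^ j + u), a, s, i, f), w)))"
    by (simp only: Suc.IH[OF d(1)] Suc.IH[OF d(2)]) (simp add: distrib_left mult_ac add_ac)
  also have "(\<Sum>u<2 ^ j. \<psi> ((t + u, a, s, i, f), w)) + (\<Sum>u<2 ^ j. \<psi> ((t + (2 ^ j + u), a, s, i, f), w)) =
     (\<Sum>u<2 ^ Suc j. \<psi> ((t + u, a, s, i, f), w))"
    using sum_lessThan_add[of "\<lambda>u. \<psi> ((t + u, a, s, i, f), w)" "2 ^ j" "2 ^ j"] by (simp add: mult_2)
  finally show ?case .
qed

lemma run_add_time:
  "run m (add_time j) \<psi> ((t, a, s, i, f), w) = \<psi> ((t, a, Bit_Operations.xor s (take_bit j t), i, f), w)"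
proof (induction j arbitrary: s)
  case 0
  then show ?case by (simp add: add_time_def)
next
  case (Suc j)
  have "Bit_Operations.xor (put_bit j (bit s j \<noteq> bit t j) s) (take_bit j t) = Bit_Operations.xor s (take_bit (Suc j) t)"
    by (rule bit_eqI) (auto simp: bit_xor_iff bit_take_bit_iff less_Suc_eq)
  moreover have "run m (add_time (Suc j)) \<psi> = gate_action m (CNot (Reg1 j) (Reg3 j)) (run m (add_time j) \<psi>)"
    by (simp add: add_time_def)
  ultimately show ?case by (simp add: Suc del: not_iff)
qed

lemma vnorm_nonneg: "0 \<le> vnorm v"
  by (simp add: vnorm_def)

lemma vnorm_eq_0_iff: "vnorm v = 0 \<longleftrightarrow> v = 0\<^sub>v (dim_vec v)"
  by (auto simp: vnorm_def L2_set_eq_0_iff vec_eq_iff)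

text \<open>The zero vector is included, since it is its own normalization; a vanishing update in
  \<open>multistep_unitary\<close> is thus no special case.\<close>

lemma vnorm_normalized: "complex_of_real (vnorm v) \<cdot>\<^sub>v normalized v = v"
proof (cases "vnorm v = 0")
  case True
  then have "v = 0\<^sub>v (dim_vec v)" by (simp only: vnorm_eq_0_iff)
  then have "v $ i = 0" if "i < dim_vec v" for i using that by (metis index_zero_vec(1))
  then show ?thesis by (intro eq_vecI) (auto simp: normalized_def)
qed (simp add: normalized_def smult_smult_assoc)

lemma update_carrier:
  assumes "L \<in> carrier_vec n \<rightarrow> carrier_vec n" "S \<in> carrier_vec n \<rightarrow> carrier_vec n" "r0 \<in> carrier_vec n"
  shows "update L S r0 t \<in> carrier_vec n"
proof -
  have "(S ^^ k) x \<in> carrier_vec n" if "x \<in> carrier_vec n" for k x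
    using that assms(2) by (induction k) auto
  then show ?thesis using assms by (auto simp: update_def)
qed

context query_machine
begin

text \<open>The first Hadamard layer gives every time step the amplitude \<open>?h\<close>, and
  reading the second layer at 0 adds all steps with the same factor. The product of the two factors
  is \<open>1 / 2 ^ l\<close>, and the sum over the steps is the iterate.\<close>

lemma \<Psi>_good:
  assumes U: "multistep_unitary l n \<tau> \<alpha> r0 (box m) L S" and \<tau>: "\<tau> + 1 = 2 ^ l"
    and LS: "L \<in> carrier_vec n \<rightarrow> carrier_vec n" "S \<in> carrier_vec n \<rightarrow> carrier_vec n"
    and i: "i < n"
  shows "\<Psi> ((0, False, 0, i, False), 0) = iterate n \<tau> \<alpha> L S r0 $ i / 2 ^ l"
proof -
  let ?B = "labels l n" and ?h = "complex_of_real ((1 / sqrt 2) ^ l)"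
  let ?\<psi>0 = "run m (mix_time l) (start_state m)"
  let ?\<psi>1 = "gate_action m CallU ?\<psi>0"
  \<comment> \<open>The time step 0, on which U acts trivially, supplies the summand
    \<open>r0\<close> of the iterate.\<close>
  define d where "d t = (if t = 0 then r0 $ i else complex_of_real \<alpha> * update L S r0 t $ i)" for t
  have r0: "r0 \<in> carrier_vec n" using dim_r0 by (metis carrier_vec_dim_vec)
  have \<psi>0: "?\<psi>0 (z, 0) = ?h * (\<Sum>t'<2 ^ l. ket5 t' False 0 r0 False z)" if "z \<in> ?B" for z
  proof -
    obtain t a s i f where z: "z = (t, a, s, i, f)" by (cases z) auto
    have t: "t < 2 ^ l" using that by (simp add: z labels_def)
    have "(\<Sum>t'<2 ^ l. ket5 t' False 0 r0 False z) = (\<Sum>t'<2 ^ l. if t' = t then ket5 t False 0 r0 False z else 0)"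
      by (intro sum.cong) (auto simp: z ket5_def)
    then show ?thesis
      using t by (simp add: z run_mix_time_zero start_state_simp ket5_def)
  qed
  have \<psi>1: "?\<psi>1 ((t, False, t, i, False), 0) = ?h * d t" if t: "t < 2 ^ l" for t
  proof -
    let ?y = "(t, False, t, i, False)"
    have y: "?y \<in> ?B" using t i by (simp add: labels_def)
    have "?\<psi>1 (?y, 0) = (\<Sum>z\<in>?B. box m ?y z * (?h * (\<Sum>t'<2 ^ l. ket5 t' False 0 r0 False z)))"
      by (simp add: apply_on_def \<psi>0)
    also have "\<dots> = ?h * (\<Sum>t'<2 ^ l. apply_on ?B (box m) (ket5 t' False 0 r0 False) ?y)"
      unfolding apply_on_def by (subst sum.swap) (simp add: sum_distrib_left mult_ac)
    also have "(\<Sum>t'<2 ^ l. apply_on ?B (box m) (ket5 t' False 0 r0 False) ?y) =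
        (\<Sum>t'<2 ^ l. if t' = t then d t else 0)"
    proof (rule sum.cong[OF refl])
      fix t' :: nat assume t': "t' \<in> {..<2 ^ l}"
      show "apply_on ?B (box m) (ket5 t' False 0 r0 False) ?y = (if t' = t then d t else 0)"
      proof (cases "t' = 0")
        case True
        then have "apply_on ?B (box m) (ket5 t' False 0 r0 False) ?y = ket5 0 False 0 r0 False ?y"
          using U y by (simp add: multistep_unitary_def)
        then show ?thesis using True by (auto simp: ket5_def d_def)
      next
        case False
        then have "t' \<in> {1..\<tau>}" using t' \<tau> by auto
        then obtain G where G: "\<forall>x\<in>?B. apply_on ?B (box m) (ket5 t' False 0 r0 False) x =
          complex_of_real (\<alpha> * vnorm (update L S r0 t')) *
            ket5 t' False t' (normalized (update L S r0 t')) False x +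
          (case x of (t'', a, s, i, f) \<Rightarrow> if t'' = t' \<and> \<not> a \<and> f then G s i else 0)"
          using U unfolding multistep_unitary_def by blast
        have u: "update L S r0 t' \<in> carrier_vec n" by (rule update_carrier[OF LS r0])
        have "complex_of_real (vnorm (update L S r0 t')) * normalized (update L S r0 t') $ i = update L S r0 t' $ i"
        proof -
          have "(complex_of_real (vnorm (update L S r0 t')) \<cdot>\<^sub>v normalized (update L S r0 t')) $ i = update L S r0 t' $ i"
            by (simp only: vnorm_normalized)
          then show ?thesis using u i by (simp add: normalized_def)
        qed
        then have n: "complex_of_real (\<alpha> * vnorm (update L S r0 t')) * normalized (update L S r0 t') $ i =
            complex_of_real \<alpha> * update L S r0 t' $ i"
          by (simp add: mult.assoc)
        \<comment> \<open>The garbage carries flag 1 in register 5 and therefore vanishes at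
          \<open>?y\<close>.\<close>
        have "apply_on ?B (box m) (ket5 t' False 0 r0 False) ?y =
          complex_of_real (\<alpha> * vnorm (update L S r0 t')) * ket5 t' False t' (normalized (update L S r0 t')) False ?y"
          using bspec[OF G y] by simp
        also have "\<dots> = (if t' = t then d t else 0)"
          using n False by (auto simp: ket5_def d_def)
        finally show ?thesis .
      qed
    qed
    finally show ?thesis using t by simp
  qed
  have "\<Psi> ((0, False, 0, i, False), 0) = ?h * (\<Sum>t<2 ^ l. run m (add_time l) ?\<psi>1 ((t, False, 0, i, False), 0))"
    by (simp only: \<Psi>_def lcu_def fold_append comp_def fold.simps id_apply run_mix_time_sum[OF dvd_0_right] add_0)
  \<comment> \<open>The value 0 of register 3 after the exclusive or comes from the value
    \<open>t\<close> before it, where U has put the update.\<close>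
  also have "(\<Sum>t<2 ^ l. run m (add_time l) ?\<psi>1 ((t, False, 0, i, False), 0)) = (\<Sum>t<2 ^ l. ?h * d t)"
    by (intro sum.cong refl) (simp only: run_add_time xor.left_neutral take_bit_nat_eq_self \<psi>1 lessThan_iff)
  also have "?h * (\<Sum>t<2 ^ l. ?h * d t) = (?h * ?h) * (\<Sum>t<2 ^ l. d t)"
    by (simp only: sum_distrib_left[symmetric] mult.assoc)
  also have "?h * ?h = 1 / 2 ^ l"
  proof -
    have "(1 / sqrt 2) ^ l * (1 / sqrt 2) ^ l = (1 / 2 :: real) ^ l"
      by (simp flip: power_mult_distrib)
    then have "?h * ?h = complex_of_real ((1 / 2) ^ l)" by (simp only: of_real_mult[symmetric])
    then show ?thesis by (simp add: power_one_over)
  qed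
  also have "(\<Sum>t<2 ^ l. d t) = d 0 + (\<Sum>t=1..\<tau>. d t)"
  proof -
    have "{..<2 ^ l} = insert 0 {1..\<tau>}" using \<tau> by auto
    then show ?thesis by simp
  qed
  also have "\<dots> = iterate n \<tau> \<alpha> L S r0 $ i"
    using i by (simp add: d_def iterate_def sum_distrib_left)
  finally show ?thesis by simp
qed

end

section \<open>Programs that retry until success\<close>

text \<open>Every attempt owns four nodes, so that successive attempts may run different circuits;
  after a failure the execution goes on to the next four.\<close>

definition retry_program :: "(nat \<Rightarrow> gate list) \<Rightarrow> wire \<Rightarrow> program" where
  "retry_program gs q pc =
    (if pc mod 4 = 0 then Run (gs (pc div 4)) (pc + 1)
     else if pc mod 4 = 1 then Measure q (pc + 1) (pc + 2)
     else if pc mod 4 = 2 then Restart (pc + 2)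
     else Halt)"

lemma retry_program_simps [simp]:
  "retry_program gs q (4 * i) = Run (gs i) (4 * i + 1)"
  "retry_program gs q (4 * i + 1) = Measure q (4 * i + 2) (4 * i + 3)"
  "retry_program gs q (4 * i + 2) = Restart (4 * Suc i)"
  "retry_program gs q (4 * i + 3) = Halt"
proof -
  have "(4 * i + 1) mod 4 = 1" "(4 * i + 2) mod 4 = 2" "(4 * i + 3) mod 4 = 3" by presburger+
  then show "retry_program gs q (4 * i) = Run (gs i) (4 * i + 1)"
    "retry_program gs q (4 * i + 1) = Measure q (4 * i + 2) (4 * i + 3)"
    "retry_program gs q (4 * i + 2) = Restart (4 * Suc i)"
    "retry_program gs q (4 * i + 3) = Halt"
    unfolding retry_program_def by simp_all
qed

definition pure_output :: "machine \<Rightarrow> complex vec \<Rightarrow> state \<Rightarrow> bool" where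
  "pure_output m v \<psi> \<longleftrightarrow> (\<exists>\<chi>. \<forall>((t, a, s, i, f), w)\<in>configs m.
     \<psi> ((t, a, s, i, f), w) = \<chi> (t, a, s, f, w) * v $ i)"

lemma pure_output_scale:
  assumes "pure_output m v \<psi>" shows "pure_output m v (\<lambda>x. c * \<psi> x)"
proof -
  from assms obtain \<chi> where "\<forall>((t, a, s, i, f), w)\<in>configs m. \<psi> ((t, a, s, i, f), w) = \<chi> (t, a, s, f, w) * v $ i"
    unfolding pure_output_def by blast
  then show ?thesis unfolding pure_output_def by (intro exI[of _ "\<lambda>z. c * \<chi> z"]) auto
qed

locale retry =
  fixes m :: machine and gs :: "nat \<Rightarrow> gate list" and q :: wire and v :: "complex vec"
    and fail :: "nat \<Rightarrow> real"
  assumes start1: "weight m (start_state m) = 1"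
    and success_weight: "weight m (\<lambda>x. if read_wire q x then run m (gs i) (start_state m) x else 0) = 1 - fail i"
    and fail_weight: "weight m (\<lambda>x. if read_wire q x then 0 else run m (gs i) (start_state m) x) = fail i"
    and success_pure: "pure_output m v (\<lambda>x. if read_wire q x then run m (gs i) (start_state m) x else 0)"
begin

abbreviation P :: program where "P \<equiv> retry_program gs q"

text \<open>A product, because each restart prepares the start state afresh and the attempts are
  independent.\<close>

definition survival :: "nat \<Rightarrow> real" where
  "survival i = (\<Prod>j<i. fail j)"

lemma survival_simps [simp]: "survival 0 = 1" "survival (Suc i) = survival i * fail i"
  by (simp_all add: survival_def)

lemma fail_bounds: "0 \<le> fail i" "fail i \<le> 1"
  using weight_nonneg[of m] success_weight[of i] fail_weight[of i] by (metis, smt (verit))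

lemma survival_nonneg: "0 \<le> survival i"
  by (simp add: survival_def prod_nonneg fail_bounds)

lemma survival_antimono: "survival (Suc i) \<le> survival i"
  using fail_bounds[of i] survival_nonneg[of i] by (simp add: mult_left_le)

text \<open>Branch states are unnormalized: \<open>sqrt (survival i)\<close> is the amplitude that
  \<open>Restart\<close> hands on, so that weights are probabilities.\<close>

definition out :: "nat \<Rightarrow> state" where
  "out i = (\<lambda>x. complex_of_real (sqrt (survival i)) * run m (gs i) (start_state m) x)"

definition live :: "nat \<Rightarrow> state" where
  "live i = (\<lambda>x. complex_of_real (sqrt (survival i)) * start_state m x)"

definition hit :: "nat \<Rightarrow> state" where
  "hit i = (\<lambda>x. if read_wire q x then out i x else 0)"

definition miss :: "nat \<Rightarrow> state" where
  "miss i = (\<lambda>x. if read_wire q x then 0 else out i x)"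

lemma hit_scaled: "hit i = (\<lambda>x. complex_of_real (sqrt (survival i)) * (if read_wire q x then run m (gs i) (start_state m) x else 0))"
  and miss_scaled: "miss i = (\<lambda>x. complex_of_real (sqrt (survival i)) * (if read_wire q x then 0 else run m (gs i) (start_state m) x))"
  by (auto simp: hit_def miss_def out_def)

lemma weights:
  "weight m (live i) = survival i" "weight m (out i) = survival i"
  "weight m (hit i) = survival i - survival (Suc i)" "weight m (miss i) = survival (Suc i)"
proof -
  show h: "weight m (hit i) = survival i - survival (Suc i)" and m: "weight m (miss i) = survival (Suc i)"
    unfolding hit_scaled miss_scaled weight_scale
    using survival_nonneg[of i] by (simp_all add: success_weight fail_weight algebra_simps)
  show "weight m (live i) = survival i"
    unfolding live_def weight_scale using survival_nonneg[of i] by (simp add: start1)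
  show "weight m (out i) = survival i"
    using weight_split[of m "out i" "read_wire q"] h m by (simp add: hit_def miss_def)
qed

definition halted :: "(nat \<times> state) list \<Rightarrow> bool" where
  "halted H \<longleftrightarrow> (\<forall>(pc, \<psi>)\<in>set H. P pc = Halt \<and> pure_output m v \<psi>)"

definition total :: "(nat \<times> state) list \<Rightarrow> real" where
  "total H = (\<Sum>(pc, \<psi>)\<leftarrow>H. if P pc = Halt then weight m \<psi> else 0)"

definition cost :: "real \<Rightarrow> (nat \<times> state) list \<Rightarrow> real" where
  "cost C\<^sub>U H = (\<Sum>(pc, \<psi>)\<leftarrow>H. weight m \<psi> * instr_cost m C\<^sub>U (P pc))"

lemma step_halted: "halted H \<Longrightarrow> concat (map (step m P) H) = H"
  by (induction H) (auto simp: halted_def)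

lemma cost_halted: "halted H \<Longrightarrow> cost C\<^sub>U H = 0"
  by (induction H) (auto simp: halted_def cost_def)

text \<open>At any time exactly one listed branch has not halted. It stays at the head of the list,
  and the halted rest is a fixed point of \<open>step\<close>.\<close>

lemma cycle:
  assumes "branches m P (3 * i) = (4 * i, live i) # H" "halted H"
  shows "branches m P (3 * i + 1) = (4 * i + 1, out i) # H"
    and "branches m P (3 * i + 2) = (4 * i + 2, miss i) # (4 * i + 3, hit i) # H"
    and "branches m P (3 * i + 3) = (4 * Suc i, live (Suc i)) # (4 * i + 3, hit i) # H"
    and "halted ((4 * i + 3, hit i) # H)"
proof -
  show 1: "branches m P (3 * i + 1) = (4 * i + 1, out i) # H"
    using assms by (simp add: step_halted live_def out_def run_scale)
  have "branches m P (Suc (3 * i + 1)) = (4 * i + 2, miss i) # (4 * i + 3, hit i) # H"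
    unfolding branches.simps(2) 1 list.map concat.simps step_halted[OF assms(2)]
    by (simp only: step.simps retry_program_simps instr.case append.simps hit_def miss_def)
  then show 2: "branches m P (3 * i + 2) = (4 * i + 2, miss i) # (4 * i + 3, hit i) # H"
    by simp
  show h: "halted ((4 * i + 3, hit i) # H)"
    using assms(2) pure_output_scale[OF success_pure[of i]] retry_program_simps(4)[of gs q i]
    unfolding hit_scaled halted_def by auto
  have "branches m P (Suc (3 * i + 2)) = (4 * Suc i, live (Suc i)) # (4 * i + 3, hit i) # H"
    unfolding branches.simps(2) 2 list.map(2)[of _ "(4 * i + 2, miss i)"] concat.simps step_halted[OF h]
    by (simp only: step.simps retry_program_simps instr.case append.simps live_def weights)
  then show "branches m P (3 * i + 3) = (4 * Suc i, live (Suc i)) # (4 * i + 3, hit i) # H"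
    by (simp add: numeral_3_eq_3)
qed

lemma branches_cycle:
  obtains H where "branches m P (3 * i) = (4 * i, live i) # H" "halted H" "total H = 1 - survival i"
proof -
  have "\<exists>H. branches m P (3 * i) = (4 * i, live i) # H \<and> halted H \<and> total H = 1 - survival i"
  proof (induction i)
    case 0
    then show ?case by (simp add: live_def halted_def total_def)
  next
    case (Suc i)
    then obtain H where H: "branches m P (3 * i) = (4 * i, live i) # H" "halted H" "total H = 1 - survival i"
      by blast
    have "total ((4 * i + 3, hit i) # H) = 1 - survival (Suc i)"
      using H(3) retry_program_simps(4)[of gs q i] by (simp add: total_def weights)
    then show ?case
      using cycle(3,4)[OF H(1,2)] by (intro exI[of _ "(4 * i + 3, hit i) # H"]) (simp add: add.commute)
  qed
  then show ?thesis using that by blast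
qed

text \<open>The case \<open>restart\<close> is the moment between measurement and restart, when the
  success of attempt \<open>i\<close> is already counted.\<close>

lemma branch_cases:
  obtains (run) i pc \<psi> H where "r div 3 = i" "branches m P r = (pc, \<psi>) # H" "P pc \<noteq> Halt" "halted H" "total H = 1 - survival i"
  | (restart) i pc \<psi> H where "r div 3 = i" "branches m P r = (pc, \<psi>) # H" "P pc \<noteq> Halt" "halted H" "total H = 1 - survival (Suc i)"
proof -
  obtain i k where r: "r = 3 * i + k" "k < 3" "r div 3 = i"
    by (metis mult_div_mod_eq mod_less_divisor zero_less_numeral)
  obtain H where H: "branches m P (3 * i) = (4 * i, live i) # H" "halted H" "total H = 1 - survival i"
    by (rule branches_cycle)
  note c = cycle[OF H(1,2)]
  have t: "total ((4 * i + 3, hit i) # H) = 1 - survival (Suc i)"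
    using H(3) retry_program_simps(4)[of gs q i] by (simp add: total_def weights)
  have h: "P (4 * i) \<noteq> Halt" "P (4 * i + 1) \<noteq> Halt" "P (4 * i + 2) \<noteq> Halt"
    unfolding retry_program_simps by simp_all
  consider "k = 0" | "k = 1" | "k = 2" using r(2) by linarith
  then show ?thesis
  proof cases
    case 1
    then show ?thesis using that(1)[OF r(3) _ h(1) H(2,3)] H(1) r(1) by simp
  next
    case 2
    then show ?thesis using that(1)[OF r(3) _ h(2) H(2,3)] c(1) r(1) by metis
  next
    case 3
    then show ?thesis using that(2)[OF r(3) _ h(3) c(4) t] c(2) r(1) by metis
  qed
qed

text \<open>After \<open>r\<close> instructions \<open>r div 3\<close> attempts are complete, so the
  halting probability lies between \<open>1 - survival (r div 3)\<close> and 1.\<close>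

lemma outputs:
  assumes "survival \<longlonglongrightarrow> 0"
  shows "outputs m P v"
proof -
  have eq: "(\<Sum>(pc, \<psi>)\<leftarrow>branches m P r. if P pc = Halt then weight m \<psi> else 0) = total (branches m P r)" for r
    by (simp add: total_def)
  have b: "1 - survival (r div 3) \<le> total (branches m P r)" "total (branches m P r) \<le> 1" for r
  proof -
    have "1 - survival (r div 3) \<le> total (branches m P r) \<and> total (branches m P r) \<le> 1"
    proof (cases r rule: branch_cases)
      case (run i pc \<psi> H)
      then have "total (branches m P r) = 1 - survival i" by (simp add: total_def)
      then show ?thesis using survival_nonneg[of i] run(1) by simp
    next
      case (restart i pc \<psi> H)
      then have "total (branches m P r) = 1 - survival (Suc i)" by (simp add: total_def)
      then show ?thesis using survival_nonneg[of "Suc i"] survival_antimono[of i] restart(1) by simp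
    qed
    then show "1 - survival (r div 3) \<le> total (branches m P r)" "total (branches m P r) \<le> 1" by auto
  qed
  have "filterlim (\<lambda>r::nat. r div 3) at_top at_top"
    unfolding filterlim_at_top
  proof
    fix Z :: nat
    show "\<forall>\<^sub>F r in sequentially. Z \<le> r div 3"
      unfolding eventually_sequentially by (intro exI[of _ "3 * Z"]) auto
  qed
  then have "(\<lambda>r. survival (r div 3)) \<longlonglongrightarrow> 0"
    by (rule filterlim_compose[OF assms])
  then have "(\<lambda>r. 1 - survival (r div 3)) \<longlonglongrightarrow> 1"
    using tendsto_diff[OF tendsto_const, of _ 0 sequentially 1] by simp
  then have "(\<lambda>r. total (branches m P r)) \<longlonglongrightarrow> 1"
    by (rule tendsto_sandwich[OF always_eventually always_eventually _ tendsto_const, rotated 2])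
      (intro allI b)+
  moreover have "pure_output m v \<psi>" if "(pc, \<psi>) \<in> set (branches m P r)" "P pc = Halt" for r pc \<psi>
    by (cases r rule: branch_cases) (use that in \<open>auto simp: halted_def\<close>)
  ultimately show ?thesis
    unfolding outputs_def eq pure_output_def by blast
qed

lemma runs_in_time:
  assumes gs: "\<And>i. 0 \<le> (\<Sum>g\<leftarrow>gs i. gate_cost C\<^sub>U g)" and C: "0 \<le> C\<^sub>U"
    and b: "\<And>R. start_cost m C\<^sub>U + (\<Sum>i<R. survival i * ((\<Sum>g\<leftarrow>gs i. gate_cost C\<^sub>U g) + 1 + start_cost m C\<^sub>U)) \<le> b"
  shows "runs_in_time m C\<^sub>U P b"
  unfolding runs_in_time_def
proof
  fix r
  let ?E = "\<lambda>j. cost C\<^sub>U (branches m P j)"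
  have s: "0 \<le> start_cost m C\<^sub>U" using C by (simp add: start_cost_def)
  have cyc: "?E (3 * i) = survival i * (\<Sum>g\<leftarrow>gs i. gate_cost C\<^sub>U g)" "?E (3 * i + 1) = survival i"
    "?E (3 * i + 2) = survival (Suc i) * start_cost m C\<^sub>U" for i
  proof -
    obtain H where H: "branches m P (3 * i) = (4 * i, live i) # H" "halted H"
      by (rule branches_cycle)
    note c = cycle[OF H]
    show "?E (3 * i) = survival i * (\<Sum>g\<leftarrow>gs i. gate_cost C\<^sub>U g)"
      using cost_halted[OF H(2)] unfolding H(1) by (simp add: cost_def weights)
    show "?E (3 * i + 1) = survival i"
      using cost_halted[OF H(2)] retry_program_simps(2)[of gs q i] unfolding c(1) by (simp add: cost_def weights)
    show "?E (3 * i + 2) = survival (Suc i) * start_cost m C\<^sub>U"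
      using cost_halted[OF c(4)] retry_program_simps(3)[of gs q i] unfolding c(2) by (simp add: cost_def weights)
  qed
  have nonneg: "0 \<le> ?E j" for j
  proof -
    have "j = 3 * (j div 3) \<or> j = 3 * (j div 3) + 1 \<or> j = 3 * (j div 3) + 2" by presburger
    moreover have "0 \<le> ?E (3 * (j div 3))" "0 \<le> ?E (3 * (j div 3) + 1)" "0 \<le> ?E (3 * (j div 3) + 2)"
      unfolding cyc using survival_nonneg fail_bounds gs s by (auto intro!: mult_nonneg_nonneg)
    ultimately show ?thesis by metis
  qed
  \<comment> \<open>Prolonging the execution to \<open>r\<close> complete attempts of three
    instructions each adds nonnegative terms only.\<close>
  have "(\<Sum>j<r. ?E j) \<le> (\<Sum>j<r * 3. ?E j)"
    by (intro sum_mono2) (auto simp: nonneg)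
  also have "\<dots> = (\<Sum>i<r. ?E (3 * i) + ?E (3 * i + 1) + ?E (3 * i + 2))"
    by (induction r) (simp_all add: eval_nat_numeral mult.commute add_ac)
  \<comment> \<open>The restart after attempt \<open>i\<close> occurs with probability
    \<open>survival (Suc i)\<close>, here estimated by \<open>survival i\<close>.\<close>
  also have "\<dots> \<le> (\<Sum>i<r. survival i * ((\<Sum>g\<leftarrow>gs i. gate_cost C\<^sub>U g) + 1 + start_cost m C\<^sub>U))"
    unfolding cyc by (intro sum_mono) (use mult_right_mono[OF survival_antimono s] in \<open>simp add: algebra_simps\<close>)
  finally have "start_cost m C\<^sub>U + (\<Sum>j<r. ?E j) \<le> b"
    using b[of r] by linarith
  then show "start_cost m C\<^sub>U + (\<Sum>j<r. \<Sum>(pc, \<psi>)\<leftarrow>branches m P j. weight m \<psi> * instr_cost m C\<^sub>U (P pc)) \<le> b"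
    by (simp add: cost_def)
qed

end

section \<open>Scheduling the attempts\<close>

text \<open>
  The pairing function runs through the antidiagonals, and the k-th one lists the first components
  \<open>0, \<dots>, k\<close>: this is stage k, with every attempt made five times.
\<close>

definition exponent :: "nat \<Rightarrow> nat" where
  "exponent i = fst (prod_decode (i div 5))"

lemma sum_lessThan_triangle: "sum F {..<triangle R} = (\<Sum>k<R. \<Sum>a<Suc k. F (triangle k + a) :: 'a :: comm_monoid_add)"
  by (induction R) (simp_all add: sum_lessThan_add add.assoc)

lemma sum_lessThan_mult: "sum F {..<N * k :: nat} = (\<Sum>i<N. \<Sum>j<k. F (k * i + j) :: 'a :: comm_monoid_add)"
proof (induction N)
  case (Suc N)
  have "Suc N * k = N * k + k" by simp
  then show ?case by (simp only: sum_lessThan_add Suc sum.lessThan_Suc mult.commute)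
qed simp

lemma prod_decode_triangle: "K \<le> k \<Longrightarrow> fst (prod_decode (triangle k + K)) = K"
  using prod_encode_inverse[of "(K, k - K)"] by (simp add: prod_encode_def)

text \<open>From \<open>K\<close> on the terms are dominated by a geometric series with ratio 3/4
  and sum \<open>4 * 3 ^ K\<close>; the earlier ones add at most \<open>3 ^ K / 2\<close>. Together
  this is the factor 9/2.\<close>

lemma sum_eventually_quartered:
  fixes Q :: "nat \<Rightarrow> real"
  assumes Q: "\<And>k. 0 \<le> Q k" "\<And>k. Q k \<le> 1" and quarter: "\<And>k. K \<le> k \<Longrightarrow> Q (Suc k) \<le> Q k / 4"
  shows "(\<Sum>k<R. Q k * 3 ^ k) \<le> 9 / 2 * 3 ^ K"
proof (cases "R \<le> K")
  case True
  have "(\<Sum>k<R. Q k * 3 ^ k) \<le> (\<Sum>k<K. Q k * 3 ^ k)"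
    using True Q by (intro sum_mono2) auto
  also have "\<dots> \<le> (\<Sum>k<K. 3 ^ k)"
    using Q by (intro sum_mono) (simp add: mult_left_le_one_le)
  also have "\<dots> \<le> 1 / 2 * 3 ^ K"
    by (induction K) auto
  finally show ?thesis using zero_le_power[of "3 :: real" K] by linarith
next
  case False
  then have "K \<le> R" by simp
  \<comment> \<open>the second summand is a potential that pays for all later terms\<close>
  then have "(\<Sum>k<R. Q k * 3 ^ k) + 4 * Q R * 3 ^ R \<le> 9 / 2 * 3 ^ K"
  proof (induction rule: dec_induct)
    case base
    have "(\<Sum>k<K. Q k * 3 ^ k) \<le> (\<Sum>k<K. 3 ^ k)"
      using Q by (intro sum_mono) (simp add: mult_left_le_one_le)
    also have "\<dots> \<le> 1 / 2 * 3 ^ K"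
      by (induction K) auto
    finally have "(\<Sum>k<K. Q k * 3 ^ k) \<le> 1 / 2 * 3 ^ K" .
    moreover have "Q K * 3 ^ K \<le> 1 * 3 ^ K" by (intro mult_right_mono Q) simp
    ultimately show ?case by linarith
  next
    case (step k)
    have "Q (Suc k) * 3 ^ k \<le> Q k / 4 * 3 ^ k"
      by (intro mult_right_mono quarter step) simp
    then show ?case using step.IH unfolding sum.lessThan_Suc power_Suc by linarith
  qed
  moreover have "0 \<le> 4 * Q R * 3 ^ R" using Q by simp
  ultimately show ?thesis by linarith
qed

text \<open>Within stage \<open>k\<close> every survival probability is at most the one at its
  start. The constant collects 5 for the repetitions, 3/2 for the sum of \<open>3 ^ b\<close> over
  \<open>b \<le> k\<close>, and 9/2 from \<open>sum_eventually_quartered\<close>: 33.75 in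
  all.\<close>

lemma schedule_sum:
  fixes p :: "nat \<Rightarrow> real"
  assumes p: "p 0 \<le> 1" "\<And>i. 0 \<le> p i" "\<And>i. p (Suc i) \<le> p i"
    and K: "\<And>i. exponent i = K \<Longrightarrow> p (Suc i) \<le> 3 / 4 * p i"
  shows "(\<Sum>i<R. p i * 3 ^ exponent i) \<le> 34 * 3 ^ K"
proof -
  have mono: "p j \<le> p i" if "i \<le> j" for i j
    using lift_Suc_antimono_le[of p, OF p(3) that] .
  define a where "a i = fst (prod_decode i)" for i
  define q where "q i = p (5 * i)" for i
  define Q where "Q k = q (triangle k)" for k
  have e: "exponent (5 * i + j) = a i" if "j < 5" for i j
    using that by (simp add: exponent_def a_def)
  have q_mono: "q j \<le> q i" if "i \<le> j" for i j
    using that by (simp add: q_def mono)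
  \<comment> \<open>Five failures, each of probability at most 3/4, leave 243/1024 of the survival
    probability.\<close>
  have quarter: "q (Suc i) \<le> q i / 4" if "a i = K" for i
  proof -
    have s: "p (Suc (5 * i + j)) \<le> 3 / 4 * p (5 * i + j)" if "j < 5" for j
      using e[OF that, of i] \<open>a i = K\<close> by (intro K) simp
    have "5 * Suc i = Suc (5 * i + 4)" by simp
    then show ?thesis
      using s[of 0] s[of 1] s[of 2] s[of 3] s[of 4] p(2)[of "5 * i"] unfolding q_def
      by (simp add: eval_nat_numeral)
  qed
  \<comment> \<open>Stage \<open>k\<close> contains the block with exponent \<open>K\<close>, at
    position \<open>triangle k + K\<close>. The other blocks of the stage can only lower the
    survival probability further.\<close>
  have Q: "Q (Suc k) \<le> Q k / 4" if "K \<le> k" for k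
  proof -
    have "Q (Suc k) \<le> q (Suc (triangle k + K))"
      unfolding Q_def by (rule q_mono) (use that in simp)
    also have "\<dots> \<le> q (triangle k + K) / 4"
      by (rule quarter) (simp add: a_def prod_decode_triangle that)
    also have "q (triangle k + K) \<le> Q k"
      unfolding Q_def by (rule q_mono) simp
    finally show ?thesis by simp
  qed
  have Q01: "0 \<le> Q k" "Q k \<le> 1" for k
    using p(1) p(2)[of "5 * triangle k"] mono[of 0 "5 * triangle k"] by (simp_all add: Q_def q_def)
  \<comment> \<open>This pads the sum to whole stages, namely the first \<open>R\<close> of
    them.\<close>
  have "R \<le> triangle R" by (induction R) auto
  then have "(\<Sum>i<R. p i * 3 ^ exponent i) \<le> (\<Sum>i<triangle R * 5. p i * 3 ^ exponent i)"
    using p(2) by (intro sum_mono2) auto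
  also have "\<dots> = (\<Sum>i<triangle R. \<Sum>j<5. p (5 * i + j) * 3 ^ exponent (5 * i + j))"
    by (rule sum_lessThan_mult)
  also have "\<dots> \<le> (\<Sum>i<triangle R. 5 * (q i * 3 ^ a i))"
  proof (rule sum_mono)
    fix i
    have "(\<Sum>j<5. p (5 * i + j) * 3 ^ exponent (5 * i + j)) \<le> (\<Sum>j<5::nat. q i * 3 ^ a i)"
      by (intro sum_mono) (simp add: e q_def mono)
    then show "(\<Sum>j<5. p (5 * i + j) * 3 ^ exponent (5 * i + j)) \<le> 5 * (q i * 3 ^ a i)" by simp
  qed
  also have "\<dots> = (\<Sum>k<R. \<Sum>b\<le>k. 5 * (q (triangle k + b) * 3 ^ b))"
    unfolding sum_lessThan_triangle lessThan_Suc_atMost by (intro sum.cong refl) (simp add: a_def prod_decode_triangle)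
  also have "\<dots> \<le> (\<Sum>k<R. 15 / 2 * (Q k * 3 ^ k))"
  proof (rule sum_mono)
    fix k
    have "(\<Sum>b\<le>k. 5 * (q (triangle k + b) * 3 ^ b)) \<le> (\<Sum>b\<le>k. 5 * Q k * 3 ^ b)"
      unfolding Q_def by (intro sum_mono) (simp add: q_mono)
    also have "\<dots> = 5 * Q k * (\<Sum>b\<le>k. 3 ^ b)" by (simp add: sum_distrib_left)
    also have "(\<Sum>b\<le>k. 3 ^ b) \<le> (3 / 2 * 3 ^ k :: real)" by (induction k) auto
    finally show "(\<Sum>b\<le>k. 5 * (q (triangle k + b) * 3 ^ b)) \<le> 15 / 2 * (Q k * 3 ^ k)"
      using Q01(1)[of k] by (simp add: mult_left_mono)
  qed
  also have "\<dots> = 15 / 2 * (\<Sum>k<R. Q k * 3 ^ k)" by (simp add: sum_distrib_left)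
  also have "\<dots> \<le> 15 / 2 * (9 / 2 * 3 ^ K)"
    by (intro mult_left_mono sum_eventually_quartered Q Q01) simp_all
  also have "\<dots> \<le> 34 * 3 ^ K" by simp
  finally show ?thesis .
qed

text \<open>Minimality of \<open>K\<close> keeps \<open>3 ^ K * x\<close> at or below
  \<open>pi / 2\<close>; for \<open>K = 0\<close> the hypothesis on \<open>x\<close> does. The same
  upper bound limits \<open>3 ^ K\<close>, because \<open>sin x \<le> x\<close> and
  \<open>pi / 2 \<le> 2\<close>.\<close>

lemma triple_angle_large:
  fixes x :: real
  assumes "0 < x" "x \<le> pi / 2"
  obtains K where "1 / 4 \<le> (sin (3 ^ K * x))\<^sup>2" "3 ^ K \<le> 2 / sin x"
proof -
  obtain k where "pi / 6 / x < 3 ^ k" using real_arch_pow[of 3] by auto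
  then have "pi / 6 \<le> 3 ^ k * x" using assms(1) by (simp add: pos_divide_less_eq)
  then have "\<exists>k. pi / 6 \<le> 3 ^ k * x" ..
  define K where "K = (LEAST k. pi / 6 \<le> 3 ^ k * x)"
  have K1: "pi / 6 \<le> 3 ^ K * x" unfolding K_def by (rule LeastI_ex) fact
  have K2: "3 ^ K * x \<le> pi / 2"
  proof (cases K)
    case (Suc k)
    then have "\<not> pi / 6 \<le> 3 ^ k * x" using not_less_Least[of k "\<lambda>k. pi / 6 \<le> 3 ^ k * x"] by (simp add: K_def)
    then show ?thesis using Suc by simp
  qed (use assms in simp)
  have "sin (pi / 6) \<le> sin (3 ^ K * x)"
    by (rule sin_monotone_2pi_le) (use K1 K2 pi_gt_zero in linarith)+
  then have "1 / 2 \<le> sin (3 ^ K * x)" by (simp add: sin_30)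
  then have "(1 / 2)\<^sup>2 \<le> (sin (3 ^ K * x))\<^sup>2" by (intro power_mono) simp_all
  then have 1: "1 / 4 \<le> (sin (3 ^ K * x))\<^sup>2" by (simp add: power2_eq_square)
  have s: "0 < sin x" using assms by (intro sin_gt_zero) (use pi_gt_zero in linarith)+
  have "3 ^ K * sin x \<le> 3 ^ K * x"
    using sin_x_le_x[of x] assms by simp
  also have "\<dots> \<le> 2" using K2 pi_less_4 by linarith
  finally have "3 ^ K \<le> 2 / sin x" using s by (simp add: pos_le_divide_eq)
  with 1 show ?thesis by (rule that)
qed

definition iterations :: "nat \<Rightarrow> nat" where
  "iterations e = (3 ^ e - 1) div 2"

lemma iterations: "2 * real (iterations e) + 1 = 3 ^ e"
proof -
  have "odd (3 ^ e :: nat)" by simp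
  then have "2 * iterations e + 1 = 3 ^ e" unfolding iterations_def by presburger
  then have "real (2 * iterations e + 1) = real (3 ^ e)" by simp
  then show ?thesis by simp
qed

section \<open>Cost of one attempt and expected cost of the program\<close>

definition circuit_cost :: "real \<Rightarrow> gate list \<Rightarrow> real" where
  "circuit_cost C gs = (\<Sum>g\<leftarrow>gs. gate_cost C g)"

lemma circuit_cost_simps [simp]:
  "circuit_cost C [] = 0" "circuit_cost C (g # gs) = gate_cost C g + circuit_cost C gs"
  "circuit_cost C (gs @ hs) = circuit_cost C gs + circuit_cost C hs"
  by (simp_all add: circuit_cost_def)

lemma circuit_cost_concat_replicate: "circuit_cost C (concat (replicate j gs)) = real j * circuit_cost C gs"
  by (induction j) (simp_all add: algebra_simps)

lemma circuit_cost_adjoint: "circuit_cost C (adjoint_circuit gs) = circuit_cost C gs"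
proof -
  have "gate_cost C (adjoint_gate g) = gate_cost C g" for g by (cases g) auto
  then show ?thesis
    by (simp add: circuit_cost_def adjoint_circuit_def rev_map[symmetric] comp_def)
qed

lemma circuit_cost_lcu: "circuit_cost C (lcu l) = C + 3 * real l"
  by (simp add: lcu_def mix_time_def add_time_def) (simp add: circuit_cost_def comp_def sum_list_triv)

lemma circuit_cost_zero_test: "circuit_cost C (zero_test l) = 4 * real l + 5"
proof -
  have "circuit_cost C (ladder q N) = 1 + 2 * real N" for q N
    unfolding ladder_def by (induction N) simp_all
  then show ?thesis by (simp add: zero_test_def)
qed

lemma circuit_cost_attempt:
  assumes "1 \<le> C"
  shows "0 \<le> circuit_cost C (attempt l j)" "circuit_cost C (attempt l j) \<le> 13 * (2 * real j + 1) * (C + real l)"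
proof -
  \<comment> \<open>Four zero tests, two runs of \<open>lcu\<close> or its adjoint, one phase gate,
    and one reflection, which is charged like a call of U.\<close>
  have g: "circuit_cost C (grover l) = 3 * C + 22 * real l + 21"
    by (simp add: grover_def circuit_cost_adjoint circuit_cost_lcu circuit_cost_zero_test)
  have a: "circuit_cost C (attempt l j) = C + 7 * real l + 5 + real j * (3 * C + 22 * real l + 21)"
    by (simp add: attempt_def circuit_cost_concat_replicate g circuit_cost_lcu circuit_cost_zero_test)
  show "0 \<le> circuit_cost C (attempt l j)" using assms unfolding a by simp
  have "real j * (3 * C + 22 * real l + 21) \<le> real j * (26 * C + 26 * real l)"
    using assms by (intro mult_left_mono) auto
  then show "circuit_cost C (attempt l j) \<le> 13 * (2 * real j + 1) * (C + real l)"
    unfolding a using assms by (simp add: algebra_simps)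
qed

text \<open>The program is built from \<open>l\<close> alone; neither the angle nor the dimension of
  the state register enters.\<close>

definition amplification_program :: "nat \<Rightarrow> program" where
  "amplification_program l = retry_program (\<lambda>i. attempt l (iterations (exponent i))) (result_wire l)"

lemma valid_amplification_program: "valid_program l (2 * l + 3) (amplification_program l)"
  unfolding valid_program_def
proof
  fix pc
  have "valid_circuit l (2 * l + 3) (attempt l j)" for j by (rule valid_attempt) simp
  then show "case amplification_program l pc of Run gs _ \<Rightarrow> valid_circuit l (2 * l + 3) gs
    | Measure q _ _ \<Rightarrow> valid_wire l (2 * l + 3) q | _ \<Rightarrow> True"
    by (simp add: amplification_program_def retry_program_def)
qed

context query_machine
begin

text \<open>The constant is \<open>20 * 34 * 2 + 6\<close>. Relative to
  \<open>3 ^ exponent i * (C\<^sub>U + real l)\<close> the circuit of an attempt costs at most 13,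
  its measurement and restart at most 7. The 34 comes from \<open>schedule_sum\<close>, the 2 from
  \<open>3 ^ K \<le> 2 / sqrt p\<close>, and 6 pays for the first preparation.\<close>

lemma amplification_program:
  assumes p: "0 < p" and C: "1 \<le> C\<^sub>U"
    and good: "\<And>i. i < n \<Longrightarrow> \<Psi> ((0, False, 0, i, False), 0) = c * v $ i"
  shows "outputs m (amplification_program l) v"
    and "runs_in_time m C\<^sub>U (amplification_program l) (1366 * (1 / sqrt p * (C\<^sub>U + real l)))"
proof -
  let ?gs = "\<lambda>i. attempt l (iterations (exponent i))"
  define fail where "fail i = (cos (3 ^ exponent i * angle))\<^sup>2" for i
  interpret retry m ?gs "result_wire l" v fail
  proof
    fix i
    note f = final_spec[where j = "iterations (exponent i)", unfolded final_def iterations]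
    show "weight m (start_state m) = 1" by simp
    show "weight m (\<lambda>x. if read_wire (result_wire l) x then run m (?gs i) (start_state m) x else 0) = 1 - fail i"
      unfolding f(1) fail_def by (simp add: sin_squared_eq)
    show "weight m (\<lambda>x. if read_wire (result_wire l) x then 0 else run m (?gs i) (start_state m) x) = fail i"
      unfolding fail_def by (rule f(2))
    show "pure_output m v (\<lambda>x. if read_wire (result_wire l) x then run m (?gs i) (start_state m) x else 0)"
      unfolding pure_output_def by (rule f(3)) (rule good)
  qed
  have "0 < sin angle" using p by (simp add: sin_angle)
  then have "0 < angle" using angle_bounds(1) by (cases "angle = 0") auto
  then obtain K where K: "1 / 4 \<le> (sin (3 ^ K * angle))\<^sup>2" "3 ^ K \<le> 2 / sqrt p"
    using triple_angle_large angle_bounds(2) by (metis sin_angle)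
  have sum: "(\<Sum>i<R. survival i * 3 ^ exponent i) \<le> 34 * 3 ^ K" for R
  proof (rule schedule_sum)
    fix i assume "exponent i = K"
    then have "fail i \<le> 3 / 4" using K(1) by (simp add: fail_def cos_squared_eq)
    then show "survival (Suc i) \<le> 3 / 4 * survival i"
      using mult_right_mono[OF \<open>fail i \<le> 3 / 4\<close> survival_nonneg[of i]] by (simp add: mult.commute)
  qed (use survival_nonneg survival_antimono in simp_all)
  \<comment> \<open>As \<open>3 ^ exponent i\<close> is at least 1, the bound on the cost also
    bounds the plain sum of the survival probabilities. They tend to 0, and the program halts almost
    surely.\<close>
  have "summable survival"
  proof (rule bounded_imp_summable)
    fix R
    have "(\<Sum>i\<le>R. survival i) \<le> (\<Sum>i<Suc R. survival i * 3 ^ exponent i)"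
      unfolding lessThan_Suc_atMost using mult_left_mono[OF one_le_power[of 3] survival_nonneg] by (intro sum_mono) simp
    then show "(\<Sum>i\<le>R. survival i) \<le> 34 * 3 ^ K" using sum[of "Suc R"] by linarith
  qed (rule survival_nonneg)
  then show "outputs m (amplification_program l) v"
    unfolding amplification_program_def by (intro outputs summable_LIMSEQ_zero)
  let ?D = "C\<^sub>U + real l"
  have D: "0 \<le> ?D" using C by simp
  have s: "start_cost m C\<^sub>U \<le> 6 * ?D" using C by (simp add: start_cost_def)
  show "runs_in_time m C\<^sub>U (amplification_program l) (1366 * (1 / sqrt p * ?D))"
    unfolding amplification_program_def
  proof (rule runs_in_time)
    show "0 \<le> (\<Sum>g\<leftarrow>?gs i. gate_cost C\<^sub>U g)" for i
      using circuit_cost_attempt(1)[OF C] by (simp add: circuit_cost_def)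
    show "0 \<le> C\<^sub>U" using C by simp
    fix R
    have "(\<Sum>i<R. survival i * ((\<Sum>g\<leftarrow>?gs i. gate_cost C\<^sub>U g) + 1 + start_cost m C\<^sub>U))
      \<le> (\<Sum>i<R. 20 * ?D * (survival i * 3 ^ exponent i))"
    proof (rule sum_mono)
      fix i
      have "(\<Sum>g\<leftarrow>?gs i. gate_cost C\<^sub>U g) \<le> 13 * 3 ^ exponent i * ?D"
        using circuit_cost_attempt(2)[OF C, of l "iterations (exponent i)"]
        by (simp only: circuit_cost_def iterations)
      moreover have "1 + start_cost m C\<^sub>U \<le> 7 * ?D" using C by (simp add: start_cost_def)
      moreover have "7 * ?D * 1 \<le> 7 * ?D * 3 ^ exponent i" using D by (intro mult_left_mono) simp_all
      ultimately have "(\<Sum>g\<leftarrow>?gs i. gate_cost C\<^sub>U g) + 1 + start_cost m C\<^sub>U \<le> 20 * ?D * 3 ^ exponent i"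
        by (simp add: algebra_simps)
      from mult_left_mono[OF this survival_nonneg[of i]]
      show "survival i * ((\<Sum>g\<leftarrow>?gs i. gate_cost C\<^sub>U g) + 1 + start_cost m C\<^sub>U) \<le> 20 * ?D * (survival i * 3 ^ exponent i)"
        by (simp only: mult_ac)
    qed
    also have "\<dots> = 20 * ?D * (\<Sum>i<R. survival i * 3 ^ exponent i)" by (simp only: sum_distrib_left)
    also have "\<dots> \<le> 20 * ?D * (34 * (2 / sqrt p))"
      using sum[of R] K(2) D by (intro mult_left_mono) simp_all
    also have "\<dots> = 1360 * (1 / sqrt p * ?D)" by simp
    finally have "(\<Sum>i<R. survival i * ((\<Sum>g\<leftarrow>?gs i. gate_cost C\<^sub>U g) + 1 + start_cost m C\<^sub>U)) \<le> 1360 * (1 / sqrt p * ?D)" .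
    moreover have "6 * ?D \<le> 6 * (1 / sqrt p * ?D)"
    proof -
      have "1 \<le> 1 / sqrt p" using p p_bounds by simp
      from mult_right_mono[OF this D] show ?thesis by linarith
    qed
    ultimately show "start_cost m C\<^sub>U + (\<Sum>i<R. survival i * ((\<Sum>g\<leftarrow>?gs i. gate_cost C\<^sub>U g) + 1 + start_cost m C\<^sub>U))
      \<le> 1366 * (1 / sqrt p * ?D)"
      using s by linarith
  qed
qed

end

section \<open>Normalized states and the main theorem\<close>

lemma vnorm_sum_le:
  assumes "finite A"
  shows "vnorm (vec n (\<lambda>i. \<Sum>t\<in>A. F t i)) \<le> (\<Sum>t\<in>A. vnorm (vec n (F t)))"
  using assms
proof (induction A)
  case empty
  then show ?case by (simp add: vnorm_def L2_set_def)
next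
  case (insert s A)
  have "vnorm (vec n (\<lambda>i. \<Sum>t\<in>insert s A. F t i)) = L2_set (\<lambda>i. cmod (F s i + (\<Sum>t\<in>A. F t i))) {..<n}"
    unfolding vnorm_def by (intro L2_set_cong) (use insert in simp_all)
  also have "\<dots> \<le> L2_set (\<lambda>i. cmod (F s i) + cmod (\<Sum>t\<in>A. F t i)) {..<n}"
    by (intro L2_set_mono norm_triangle_ineq) simp
  also have "\<dots> \<le> L2_set (\<lambda>i. cmod (F s i)) {..<n} + L2_set (\<lambda>i. cmod (\<Sum>t\<in>A. F t i)) {..<n}"
    by (rule L2_set_triangle_ineq)
  also have "\<dots> = vnorm (vec n (F s)) + vnorm (vec n (\<lambda>i. \<Sum>t\<in>A. F t i))"
    unfolding vnorm_def by (intro arg_cong2[where f = "(+)"] L2_set_cong) simp_all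
  finally show ?case using insert by simp
qed

lemma vnorm_smult: "vnorm (c \<cdot>\<^sub>v v) = cmod c * vnorm v"
proof -
  have "vnorm (c \<cdot>\<^sub>v v) = L2_set (\<lambda>i. cmod c * cmod (v $ i)) {..<dim_vec v}"
    unfolding vnorm_def by (intro L2_set_cong) (simp_all add: norm_mult)
  also have "\<dots> = cmod c * vnorm v"
    unfolding vnorm_def by (rule L2_set_right_distrib[symmetric]) simp
  finally show ?thesis .
qed

text \<open>\<open>r0\<close> cancels. Each of the \<open>\<tau>\<close> errors is at most
  \<open>t * \<epsilon>\<close>, estimated by \<open>\<tau> * \<epsilon>\<close>, hence the square
  of \<open>\<tau>\<close>.\<close>

lemma iterate_diff:
  assumes carrier: "\<And>t. update L S r0 t \<in> carrier_vec n" "\<And>t. update L' S' r0 t \<in> carrier_vec n"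
    and "0 < \<tau>" "0 \<le> \<alpha>" "0 \<le> \<epsilon>"
    and acc: "\<And>t. t \<in> {1..\<tau>} \<Longrightarrow> accurate_at L S L' S' r0 \<epsilon> t"
  shows "vnorm (iterate n \<tau> \<alpha> L S r0 - iterate n \<tau> \<alpha> L' S' r0) \<le> \<alpha> * (real \<tau>)\<^sup>2 * \<epsilon>"
proof -
  let ?d = "\<lambda>t i. update L S r0 t $ i - update L' S' r0 t $ i"
  have "iterate n \<tau> \<alpha> L S r0 - iterate n \<tau> \<alpha> L' S' r0 = complex_of_real \<alpha> \<cdot>\<^sub>v vec n (\<lambda>i. \<Sum>t=1..\<tau>. ?d t i)"
    by (intro eq_vecI) (simp_all add: iterate_def sum_subtractf right_diff_distrib)
  then have "vnorm (iterate n \<tau> \<alpha> L S r0 - iterate n \<tau> \<alpha> L' S' r0) = \<alpha> * vnorm (vec n (\<lambda>i. \<Sum>t=1..\<tau>. ?d t i))"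
    using assms by (simp add: vnorm_smult)
  also have "vnorm (vec n (\<lambda>i. \<Sum>t=1..\<tau>. ?d t i)) \<le> (\<Sum>t=1..\<tau>. vnorm (vec n (?d t)))"
    by (rule vnorm_sum_le) simp
  also have "\<dots> \<le> (\<Sum>t=1..\<tau>. real \<tau> * \<epsilon>)"
  proof (rule sum_mono)
    fix t assume t: "t \<in> {1..\<tau>}"
    have "vec n (?d t) = update L S r0 t - update L' S' r0 t"
      using carrier[of t] by (intro eq_vecI) auto
    then have "vnorm (vec n (?d t)) \<le> real t * \<epsilon>" using acc[OF t] by (simp add: accurate_at_def)
    also have "\<dots> \<le> real \<tau> * \<epsilon>" using t assms by (intro mult_right_mono) auto
    finally show "vnorm (vec n (?d t)) \<le> real \<tau> * \<epsilon>" .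
  qed
  also have "\<dots> = (real \<tau>)\<^sup>2 * \<epsilon>" by (simp add: power2_eq_square)
  finally show ?thesis using assms by (simp add: mult_left_mono mult.assoc)
qed

text \<open>The law of cosines; the real coefficients let it serve both \<open>x - y\<close> and the
  sums and differences of the normalized vectors.\<close>

lemma vnorm_combination_square:
  assumes "dim_vec x = n" "dim_vec y = n"
  shows "(vnorm (complex_of_real a \<cdot>\<^sub>v x - complex_of_real b \<cdot>\<^sub>v y))\<^sup>2 =
    a\<^sup>2 * (vnorm x)\<^sup>2 + b\<^sup>2 * (vnorm y)\<^sup>2 - 2 * a * b * Re (x \<bullet>c y)"
proof -
  have "(cmod (complex_of_real a * u - complex_of_real b * w))\<^sup>2 =
    a\<^sup>2 * (cmod u)\<^sup>2 + b\<^sup>2 * (cmod w)\<^sup>2 - 2 * a * b * Re (u * cnj w)" for u w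
    by (simp only: cmod_power2) (simp add: power2_eq_square algebra_simps)
  then have "(vnorm (complex_of_real a \<cdot>\<^sub>v x - complex_of_real b \<cdot>\<^sub>v y))\<^sup>2 =
    (\<Sum>i<n. a\<^sup>2 * (cmod (x $ i))\<^sup>2 + b\<^sup>2 * (cmod (y $ i))\<^sup>2 - 2 * a * b * Re (x $ i * cnj (y $ i)))"
    unfolding vnorm_square by (intro sum.cong) (use assms in simp_all)
  moreover have "Re (x \<bullet>c y) = (\<Sum>i<n. Re (x $ i * cnj (y $ i)))"
    using assms by (simp add: scalar_prod_def lessThan_atLeast0)
  ultimately show ?thesis
    using assms by (simp only: vnorm_square sum_distrib_left sum.distrib sum_subtractf)
qed

text \<open>Let \<kappa> be the cosine of the angle. The unit vectors have squared distance
  \<open>2 - 2 * \<kappa>\<close>, while for \<open>\<kappa> \<ge> 0\<close> no point on the ray of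
  \<open>y\<close> is closer to \<open>x\<close> than the squared distance
  \<open>1 - \<kappa>\<^sup>2\<close> in units of \<open>vnorm x\<close>. The quotient
  \<open>2 / (1 + \<kappa>)\<close> is at most 2, which is where \<open>sqrt 2\<close>
  originates.\<close>

lemma ket_close_of_distance:
  assumes dim: "x \<in> carrier_vec n" "y \<in> carrier_vec n" and x: "x \<noteq> 0\<^sub>v n" and d: "vnorm (x - y) \<le> d"
  shows "ket_close x y (sqrt 2 * d / vnorm x)"
proof -
  let ?X = "vnorm x" and ?Y = "vnorm y" and ?D = "vnorm (x - y)" and ?\<rho> = "Re (x \<bullet>c y)"
  have dims: "dim_vec x = n" "dim_vec y = n" using dim by auto
  note sq = vnorm_combination_square[OF dims]
  have X: "0 < ?X" using x dims vnorm_eq_0_iff[of x] vnorm_nonneg[of x] by (metis less_eq_real_def)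
  have D: "?D\<^sup>2 = ?X\<^sup>2 + ?Y\<^sup>2 - 2 * ?\<rho>"
  proof -
    have "complex_of_real 1 \<cdot>\<^sub>v x - complex_of_real 1 \<cdot>\<^sub>v y = x - y" using dim by (intro eq_vecI) auto
    then show ?thesis using sq[of 1 1] by simp
  qed
  have N: "(vnorm (normalized x - complex_of_real \<sigma> \<cdot>\<^sub>v normalized y))\<^sup>2 =
      1 + (\<sigma> / ?Y)\<^sup>2 * ?Y\<^sup>2 - 2 * \<sigma> * (?\<rho> / (?X * ?Y))" for \<sigma>
  proof -
    have "normalized x - complex_of_real \<sigma> \<cdot>\<^sub>v normalized y =
      complex_of_real (1 / ?X) \<cdot>\<^sub>v x - complex_of_real (\<sigma> / ?Y) \<cdot>\<^sub>v y"
      using dim by (intro eq_vecI) (auto simp: normalized_def)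
    then show ?thesis using sq[of "1 / ?X" "\<sigma> / ?Y"] X by (simp add: power_divide)
  qed
  have le: "vnorm (normalized x - complex_of_real \<sigma> \<cdot>\<^sub>v normalized y) \<le> sqrt 2 * d / ?X"
    if "?X\<^sup>2 * (vnorm (normalized x - complex_of_real \<sigma> \<cdot>\<^sub>v normalized y))\<^sup>2 \<le> 2 * ?D\<^sup>2" for \<sigma>
  proof -
    have "(?X * vnorm (normalized x - complex_of_real \<sigma> \<cdot>\<^sub>v normalized y))\<^sup>2 \<le> (sqrt 2 * ?D)\<^sup>2"
      using that by (simp add: power_mult_distrib)
    then have "?X * vnorm (normalized x - complex_of_real \<sigma> \<cdot>\<^sub>v normalized y) \<le> sqrt 2 * ?D"
      by (rule power2_le_imp_le) (simp add: vnorm_nonneg)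
    also have "\<dots> \<le> sqrt 2 * d" using d by simp
    finally show ?thesis using X by (simp add: pos_le_divide_eq mult.commute)
  qed
  show ?thesis
  proof (cases "?Y = 0")
    case True
    \<comment> \<open>Here \<open>normalized y\<close> is zero because \<open>1 / 0 = 0\<close>, so
      the distance is 1; and \<open>?D = ?X\<close>, since \<open>?\<rho>\<close> vanishes.\<close>
    then have "y = 0\<^sub>v n" using dims vnorm_eq_0_iff[of y] by simp
    then have "?\<rho> = 0" using dims by (simp add: scalar_prod_def)
    then have "vnorm (normalized x - complex_of_real 1 \<cdot>\<^sub>v normalized y) \<le> sqrt 2 * d / ?X"
      using True by (intro le) (simp only: N D, simp)
    then show ?thesis unfolding ket_close_def by (intro exI[of _ 1]) simp
  next
    case False
    then have Y: "0 < ?Y" using vnorm_nonneg[of y] by simp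
    define \<kappa> where "\<kappa> = ?\<rho> / (?X * ?Y)" \<comment> \<open>the cosine of the angle between x and y\<close>
    have \<rho>: "?\<rho> = \<kappa> * ?X * ?Y" using X Y by (simp add: \<kappa>_def)
    have N': "(vnorm (normalized x - complex_of_real \<sigma> \<cdot>\<^sub>v normalized y))\<^sup>2 = 1 + \<sigma>\<^sup>2 - 2 * \<sigma> * \<kappa>" for \<sigma>
      using N[of \<sigma>] Y by (simp add: \<kappa>_def power_divide)
    show ?thesis
    proof (cases "0 \<le> ?\<rho>")
      case True
      then have "0 \<le> \<kappa>" using X Y by (simp add: \<kappa>_def)
      \<comment> \<open>The Cauchy-Schwarz inequality, read off from the squared distance
        \<open>2 - 2 * \<kappa>\<close> being nonnegative.\<close>
      moreover have "\<kappa> \<le> 1" using N'[of 1] zero_le_power2[of "vnorm (normalized x - complex_of_real 1 \<cdot>\<^sub>v normalized y)"] by simp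
      \<comment> \<open>This convex combination of two squares is exactly the slack
        \<open>?D\<^sup>2 - ?X\<^sup>2 * (1 - \<kappa>)\<close>.\<close>
      ultimately have "0 \<le> (1 - \<kappa>) * ?Y\<^sup>2 + \<kappa> * (?Y - ?X)\<^sup>2" by simp
      also have "\<dots> = (?X\<^sup>2 + ?Y\<^sup>2 - 2 * ?\<rho>) - ?X\<^sup>2 * (1 - \<kappa>)"
        unfolding \<rho> by (simp add: power2_eq_square algebra_simps)
      finally have "?X\<^sup>2 * (1 + 1\<^sup>2 - 2 * 1 * \<kappa>) \<le> 2 * (?X\<^sup>2 + ?Y\<^sup>2 - 2 * ?\<rho>)"
        by (simp add: algebra_simps)
      then have "vnorm (normalized x - complex_of_real 1 \<cdot>\<^sub>v normalized y) \<le> sqrt 2 * d / ?X"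
        by (intro le) (simp only: N' D)
      then show ?thesis unfolding ket_close_def by (intro exI[of _ 1]) simp
    next
      case False
      \<comment> \<open>With phase -1 the vectors are added, and the squared norm of the sum,
        \<open>2 + 2 * \<kappa>\<close>, is below 2. An obtuse angle forces
        \<open>?D \<ge> ?X\<close>.\<close>
      then have "\<kappa> < 0" using X Y by (simp add: \<kappa>_def divide_neg_pos)
      then have "?X\<^sup>2 * (1 + (- 1)\<^sup>2 - 2 * (- 1) * \<kappa>) \<le> ?X\<^sup>2 * 2"
        by (intro mult_left_mono) simp_all
      also have "\<dots> \<le> 2 * (?X\<^sup>2 + ?Y\<^sup>2 - 2 * ?\<rho>)"
        using False zero_le_power2[of ?Y] by argo
      finally have "vnorm (normalized x - complex_of_real (- 1) \<cdot>\<^sub>v normalized y) \<le> sqrt 2 * d / ?X"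
        by (intro le) (simp only: N' D)
      then show ?thesis using False unfolding ket_close_def by (intro exI[of _ "- 1"]) simp
    qed
  qed
qed

section \<open>Failure probabilities and assembly of the result\<close>

lemma with_prob_all:
  assumes "prob_space M" "finite A" and P: "\<And>t. t \<in> A \<Longrightarrow> with_prob M (1 - e t) (P t)"
    and Q: "\<And>\<omega>. \<omega> \<in> space M \<Longrightarrow> (\<And>t. t \<in> A \<Longrightarrow> P t \<omega>) \<Longrightarrow> Q \<omega>"
  shows "with_prob M (1 - (\<Sum>t\<in>A. e t)) Q"
proof -
  interpret prob_space M by fact
  have "\<forall>t\<in>A. \<exists>E. E \<in> sets M \<and> (\<forall>\<omega>\<in>E. P t \<omega>) \<and> 1 - e t \<le> measure M E"
    using P by (auto simp: with_prob_def)
  then obtain E where E: "\<And>t. t \<in> A \<Longrightarrow> E t \<in> sets M" "\<And>t \<omega>. t \<in> A \<Longrightarrow> \<omega> \<in> E t \<Longrightarrow> P t \<omega>"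
    "\<And>t. t \<in> A \<Longrightarrow> 1 - e t \<le> measure M (E t)"
    by metis
  \<comment> \<open>A union bound over the complements of the witness events; the complement of
    \<open>?bad\<close> is the event that witnesses \<open>Q\<close>.\<close>
  let ?bad = "\<Union>t\<in>A. space M - E t"
  have bad: "?bad \<in> sets M" using E(1) assms(2) by (intro sets.finite_UN) auto
  have "measure M ?bad \<le> (\<Sum>t\<in>A. measure M (space M - E t))"
    using E(1) assms(2) by (intro finite_measure_subadditive_finite) auto
  also have "\<dots> \<le> (\<Sum>t\<in>A. e t)"
    using E(1,3) by (intro sum_mono) (auto simp: prob_compl algebra_simps)
  finally have "1 - (\<Sum>t\<in>A. e t) \<le> measure M (space M - ?bad)"
    using prob_compl[OF bad] by simp
  then show ?thesis
    unfolding with_prob_def using bad E(2) by (intro bexI[of _ "space M - ?bad"]) (auto intro!: Q)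
qed

text \<open>Here \<open>L\<close> and \<open>S\<close> stand for the approximations realized by
  \<open>U\<close>, so \<open>\<theta>\<close> is the vector called \<open>\<theta>'\<close> in the
  theorem.\<close>

lemma amplification_program_multistep:
  assumes \<tau>: "0 < \<tau>" "\<tau> + 1 = 2 ^ l" and C: "1 \<le> C\<^sub>U"
    and r0: "r0 \<in> carrier_vec n" "vnorm r0 = 1"
    and LS: "L \<in> carrier_vec n \<rightarrow> carrier_vec n" "S \<in> carrier_vec n \<rightarrow> carrier_vec n"
    and U: "multistep_unitary l n \<tau> \<alpha> r0 U L S"
    and \<theta>: "\<theta> = iterate n \<tau> \<alpha> L S r0" "\<theta> \<noteq> 0\<^sub>v n"
    and m: "m = \<lparr>tbits = l, sdim = n, work = 2 * l + 3, inp = r0, box = U\<rparr>"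
  shows "outputs m (amplification_program l) (normalized \<theta>)"
    and "runs_in_time m C\<^sub>U (amplification_program l)
      (2732 * ((real \<tau> + 1) / vnorm \<theta> * (C\<^sub>U + log 2 (real \<tau>))))"
proof -
  interpret query_machine m l n r0
    using r0 U by unfold_locales (auto simp: m multistep_unitary_def)
  have dim: "dim_vec \<theta> = n" by (simp add: \<theta> iterate_def)
  have pos: "0 < vnorm \<theta>"
    using \<theta>(2) dim vnorm_eq_0_iff[of \<theta>] vnorm_nonneg[of \<theta>] by (metis less_eq_real_def)
  have g: "\<Psi> ((0, False, 0, i, False), 0) = \<theta> $ i / 2 ^ l" if "i < n" for i
    unfolding \<theta>(1) by (rule \<Psi>_good[OF _ \<tau>(2) LS that]) (use U in \<open>simp add: m\<close>)
  \<comment> \<open>The good amplitudes are those of \<open>\<theta>\<close> divided by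
    \<open>2 ^ l = \<tau> + 1\<close>, which makes \<open>1 / sqrt p\<close> the \<open>T\<close> of
    the theorem.\<close>
  have "p = (\<Sum>i<n. (cmod (\<theta> $ i))\<^sup>2 / (2 ^ l)\<^sup>2)"
    unfolding p_def weight_good[OF clean_\<Psi>]
    by (intro sum.cong refl) (simp add: g norm_divide norm_power power_divide)
  also have "\<dots> = (vnorm \<theta> / 2 ^ l)\<^sup>2"
    by (simp add: vnorm_square dim power_divide sum_divide_distrib)
  finally have p: "sqrt p = vnorm \<theta> / 2 ^ l" using pos by simp
  then have "0 < p" using pos by (metis divide_pos_pos real_sqrt_gt_0_iff zero_less_numeral zero_less_power)
  have "\<Psi> ((0, False, 0, i, False), 0) = complex_of_real (vnorm \<theta> / 2 ^ l) * normalized \<theta> $ i" if "i < n" for i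
  proof -
    have "\<theta> $ i = complex_of_real (vnorm \<theta>) * normalized \<theta> $ i"
      using that dim pos by (simp add: normalized_def)
    then show ?thesis using g[OF that] by simp
  qed
  note a = amplification_program[OF \<open>0 < p\<close> C this]
  show "outputs m (amplification_program l) (normalized \<theta>)" by (rule a(1))
  have T: "1 / sqrt p = (real \<tau> + 1) / vnorm \<theta>"
  proof -
    have "real \<tau> + 1 = 2 ^ l" using arg_cong[OF \<tau>(2), of real] by simp
    then show ?thesis by (simp add: p)
  qed
  \<comment> \<open>\<open>l\<close> exceeds \<open>log 2 \<tau>\<close> by at most 1, and
    \<open>C\<^sub>U \<ge> 1\<close> absorbs this at the price of a factor 2: hence 2732, twice
    1366.\<close>
  have "real l = log 2 (2 ^ l)" by simp
  also have "\<dots> = log 2 (real \<tau> + 1)" using arg_cong[OF \<tau>(2), of real] by (simp add: add.commute del: log_pow_cancel)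
  also have "\<dots> \<le> log 2 (2 * real \<tau>)" using \<tau>(1) by simp
  also have "\<dots> = 1 + log 2 (real \<tau>)" using \<tau>(1) by (simp add: log_mult)
  finally have "real l \<le> 1 + log 2 (real \<tau>)" .
  moreover have "0 \<le> log 2 (real \<tau>)" using \<tau>(1) by simp
  ultimately have "C\<^sub>U + real l \<le> 2 * (C\<^sub>U + log 2 (real \<tau>))"
    using C by argo
  then have "1366 * (1 / sqrt p * (C\<^sub>U + real l)) \<le> 1366 * (1 / sqrt p * (2 * (C\<^sub>U + log 2 (real \<tau>))))"
    using p_bounds(1) by (intro mult_left_mono) simp_all
  also have "\<dots> = 2732 * ((real \<tau> + 1) / vnorm \<theta> * (C\<^sub>U + log 2 (real \<tau>)))"
    unfolding T by (simp only: mult_ac) simp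
  finally show "runs_in_time m C\<^sub>U (amplification_program l)
      (2732 * ((real \<tau> + 1) / vnorm \<theta> * (C\<^sub>U + log 2 (real \<tau>))))"
    using a(2) unfolding runs_in_time_def by (meson order_trans)
qed

text \<open>Constant and programs are chosen before all other data, so a single program for each
  \<open>l\<close> serves every box, input vector and step size. The probability in the last line
  subtracts the failure probabilities of all time steps.\<close>

theorem mainTheorem4:
  shows "\<exists>C>0. \<exists>(P :: nat \<Rightarrow> program) (k :: nat \<Rightarrow> nat).
    (\<forall>l. valid_program l (k l) (P l)) \<and>
    (\<forall>l n \<tau> (\<alpha>::real) \<epsilon> \<delta> r0 L S M (C\<^sub>U::real).
       0 < \<tau> \<and> \<tau> + 1 = 2 ^ l \<and> 0 < \<alpha> \<and> 0 \<le> \<epsilon> \<and> 0 \<le> \<delta> \<and> 1 \<le> C\<^sub>U \<and>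
       r0 \<in> carrier_vec n \<and> vnorm r0 = 1 \<and>
       affine_op n L \<and> linear_op n S \<and> contracting n S \<and>
       iterate n \<tau> \<alpha> L S r0 \<noteq> 0\<^sub>v n \<and>
       multistep_procedure l n \<tau> \<alpha> r0 L S \<epsilon> \<delta> M \<longrightarrow>
       (let \<theta> = iterate n \<tau> \<alpha> L S r0;
            err = sqrt 2 * \<alpha> * (real \<tau>)\<^sup>2 * \<epsilon> / vnorm \<theta>
        in (\<forall>(U, L', S')\<in>space M.
              let \<theta>' = iterate n \<tau> \<alpha> L' S' r0;
                  T = (real \<tau> + 1) / vnorm \<theta>';
                  m = \<lparr>tbits = l, sdim = n, work = k l, inp = r0, box = U\<rparr>
              in (\<theta>' \<noteq> 0\<^sub>v n \<longrightarrow>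
                    outputs m (P l) (normalized \<theta>') \<and>
                    runs_in_time m C\<^sub>U (P l) (C * (T * (C\<^sub>U + log 2 (real \<tau>))))) \<and>
                 ((\<forall>t\<in>{1..\<tau>}. accurate_at L S L' S' r0 \<epsilon> t) \<longrightarrow> ket_close \<theta> \<theta>' err)) \<and>
           with_prob M (1 - (\<Sum>t=1..\<tau>. real t * \<delta>))
             (\<lambda>(U, L', S'). ket_close \<theta> (iterate n \<tau> \<alpha> L' S' r0) err)))"
proof (intro exI[of _ "2732 :: real"] exI[of _ amplification_program] exI[of _ "\<lambda>l. 2 * l + 3"] conjI allI impI)
  show "(0 :: real) < 2732" by simp
  show "valid_program l (2 * l + 3) (amplification_program l)" for l
    by (rule valid_amplification_program)
next
  fix l n \<tau> and \<alpha> \<epsilon> \<delta> :: real and r0 L S M and C\<^sub>U :: real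
  assume *: "0 < \<tau> \<and> \<tau> + 1 = 2 ^ l \<and> 0 < \<alpha> \<and> 0 \<le> \<epsilon> \<and> 0 \<le> \<delta> \<and> 1 \<le> C\<^sub>U \<and>
       r0 \<in> carrier_vec n \<and> vnorm r0 = 1 \<and>
       affine_op n L \<and> linear_op n S \<and> contracting n S \<and>
       iterate n \<tau> \<alpha> L S r0 \<noteq> 0\<^sub>v n \<and>
       multistep_procedure l n \<tau> \<alpha> r0 L S \<epsilon> \<delta> M"
  let ?\<theta> = "iterate n \<tau> \<alpha> L S r0" and ?\<theta>' = "\<lambda>L' S'. iterate n \<tau> \<alpha> L' S' r0"
  let ?err = "sqrt 2 * \<alpha> * (real \<tau>)\<^sup>2 * \<epsilon> / vnorm ?\<theta>"
  from * obtain A b where A: "linear_op n A" "b \<in> carrier_vec n" "\<And>x. x \<in> carrier_vec n \<Longrightarrow> L x = A x + b"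
    by (auto simp: affine_op_def)
  then have L: "L \<in> carrier_vec n \<rightarrow> carrier_vec n" by (auto simp: linear_op_def Pi_iff intro!: add_carrier_vec)
  have S: "S \<in> carrier_vec n \<rightarrow> carrier_vec n" using * by (auto simp: linear_op_def)
  have proc: "L' \<in> carrier_vec n \<rightarrow> carrier_vec n" "S' \<in> carrier_vec n \<rightarrow> carrier_vec n"
      "multistep_unitary l n \<tau> \<alpha> r0 U L' S'" if "(U, L', S') \<in> space M" for U L' S'
    using * that by (auto simp: multistep_procedure_def)
  have close: "ket_close ?\<theta> (?\<theta>' L' S') ?err"
    if "(U, L', S') \<in> space M" "\<And>t. t \<in> {1..\<tau>} \<Longrightarrow> accurate_at L S L' S' r0 \<epsilon> t" for U L' S'
  proof -
    have "vnorm (?\<theta> - ?\<theta>' L' S') \<le> \<alpha> * (real \<tau>)\<^sup>2 * \<epsilon>"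
      using * L S proc[OF that(1)] that(2) by (intro iterate_diff update_carrier) auto
    then have "ket_close ?\<theta> (?\<theta>' L' S') (sqrt 2 * (\<alpha> * (real \<tau>)\<^sup>2 * \<epsilon>) / vnorm ?\<theta>)"
      using * by (intro ket_close_of_distance[where n = n]) (auto simp: iterate_def)
    then show ?thesis by (simp only: mult.assoc)
  qed
  have 1: "let \<theta>' = iterate n \<tau> \<alpha> L' S' r0;
                  T = (real \<tau> + 1) / vnorm \<theta>';
                  m = \<lparr>tbits = l, sdim = n, work = 2 * l + 3, inp = r0, box = U\<rparr>
              in (\<theta>' \<noteq> 0\<^sub>v n \<longrightarrow>
                    outputs m (amplification_program l) (normalized \<theta>') \<and>
                    runs_in_time m C\<^sub>U (amplification_program l) (2732 * (T * (C\<^sub>U + log 2 (real \<tau>))))) \<and>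
                 ((\<forall>t\<in>{1..\<tau>}. accurate_at L S L' S' r0 \<epsilon> t) \<longrightarrow> ket_close ?\<theta> \<theta>' ?err)"
    if w: "(U, L', S') \<in> space M" for U L' S'
    unfolding Let_def
    using amplification_program_multistep[OF _ _ _ _ _ proc[OF w] refl _ refl] close[OF w] * by blast
  have 2: "with_prob M (1 - (\<Sum>t=1..\<tau>. real t * \<delta>)) (\<lambda>(U, L', S'). ket_close ?\<theta> (?\<theta>' L' S') ?err)"
  proof (rule with_prob_all)
    show "prob_space M" using * by (simp add: multistep_procedure_def)
    show "with_prob M (1 - real t * \<delta>) (\<lambda>(U, L', S'). accurate_at L S L' S' r0 \<epsilon> t)" if "t \<in> {1..\<tau>}" for t
      using * that by (simp add: multistep_procedure_def)
  qed (use close in auto)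
  show "let \<theta> = iterate n \<tau> \<alpha> L S r0;
            err = sqrt 2 * \<alpha> * (real \<tau>)\<^sup>2 * \<epsilon> / vnorm \<theta>
        in (\<forall>(U, L', S')\<in>space M.
              let \<theta>' = iterate n \<tau> \<alpha> L' S' r0;
                  T = (real \<tau> + 1) / vnorm \<theta>';
                  m = \<lparr>tbits = l, sdim = n, work = 2 * l + 3, inp = r0, box = U\<rparr>
              in (\<theta>' \<noteq> 0\<^sub>v n \<longrightarrow>
                    outputs m (amplification_program l) (normalized \<theta>') \<and>
                    runs_in_time m C\<^sub>U (amplification_program l) (2732 * (T * (C\<^sub>U + log 2 (real \<tau>))))) \<and>
                 ((\<forall>t\<in>{1..\<tau>}. accurate_at L S L' S' r0 \<epsilon> t) \<longrightarrow> ket_close \<theta> \<theta>' err)) \<and>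
           with_prob M (1 - (\<Sum>t=1..\<tau>. real t * \<delta>))
             (\<lambda>(U, L', S'). ket_close \<theta> (iterate n \<tau> \<alpha> L' S' r0) err)"
    unfolding Let_def[of "iterate n \<tau> \<alpha> L S r0"] Let_def[of ?err] using 1 2 by auto
qed

end
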